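(* Assume $s>d$ and let $\alpha>0$. Then with probability tending to $1$ as $n\to\infty$, the chemical distance in $G(X^{(n)})$ between $q(-n\mathsf{e}_1/4)$ and $q(n\mathsf{e}_1/4)$ is at least $n/(\log n)^\alpha$.
   Context: Fix an integer $d\ge2$. For $n\ge1$, $\mathbb{T}_n$ is the torus obtained from $[-n/2,n/2]^d$ by identifying opposite faces, with toroidal distance ${\rm d}_{\mathbb{T}_n}$ and $B^{\mathbb{T}_n}_r(\xi)=\{\eta\in\mathbb{T}_n:{\rm d}_{\mathbb{T}_n}(\xi,\eta)\le r\}$. $R$ is a nonnegative random variable with absolutely continuous distribution such that $\lim_{h\to\infty}h^s\mathbb{P}(R>h)=\beta$ for some $\beta,s\in(0,\infty)$. $X^{(n)}$ is a homogeneous Poisson point process of intensity $1$ on $\mathbb{T}_n$, each point independently marked with a mark in $[0,\infty)$ distributed as $R$ (points written $(\xi,r)$). The scale-free Gilbert graph $G(X^{(n)})$ has vertex set $X^{(n)}$ and a directed edge from $(\xi,r)$ to $(\eta,t)$ whenever $\eta\in B^{\mathbb{T}_n}_r(\xi)$. The chemical distance between two vertices is the minimal number of edges of a path joining them, where edges may be traversed in either direction. $\mathsf{e}_1=(1,0,\dots,0)$, and for $x\in\mathbb{T}_n$, $q(x)$ is the point of $X^{(n)}$ closest to $x$. *)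

theory Defs
  imports "HOL-Probability.Probability"
begin

definition torus_dist :: "real \<Rightarrow> real^'d \<Rightarrow> real^'d \<Rightarrow> real" where
  "torus_dist n x y = Inf {norm (x - y - n *\<^sub>R z) | z. \<forall>i. z $ i \<in> \<int>}"

text \<open>A configuration with N points: omega i = (position, mark) for i < N.
  Undirected adjacency of the scale-free Gilbert graph: there is an edge
  between i and j iff the directed edge i->j or j->i exists, where (xi,r)->(eta,t)
  iff eta lies in the closed toroidal ball of radius r around xi.\<close>
definition gilbert_adj ::
  "real \<Rightarrow> nat \<Rightarrow> (nat \<Rightarrow> (real^'d) \<times> real) \<Rightarrow> (nat \<times> nat) set" where
  "gilbert_adj n N \<omega> = {(i, j). i < N \<and> j < N \<and>
      (torus_dist n (fst (\<omega> i)) (fst (\<omega> j)) \<le> snd (\<omega> i) \<or>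
       torus_dist n (fst (\<omega> j)) (fst (\<omega> i)) \<le> snd (\<omega> j))}"

definition is_closest ::
  "real \<Rightarrow> nat \<Rightarrow> (nat \<Rightarrow> (real^'d) \<times> real) \<Rightarrow> real^'d \<Rightarrow> nat \<Rightarrow> bool" where
  "is_closest n N \<omega> x i \<longleftrightarrow> i < N \<and>
      (\<forall>j<N. torus_dist n x (fst (\<omega> i)) \<le> torus_dist n x (fst (\<omega> j)))"

definition chem_dist_ge ::
  "real \<Rightarrow> nat \<Rightarrow> (nat \<Rightarrow> (real^'d) \<times> real) \<Rightarrow> nat \<Rightarrow> nat \<Rightarrow> real \<Rightarrow> bool" where
  "chem_dist_ge n N \<omega> i j L \<longleftrightarrow>
      (\<forall>k::nat. real k < L \<longrightarrow> (i, j) \<notin> (gilbert_adj n N \<omega>) ^^ k)"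

definition marked_points :: "real \<Rightarrow> real measure \<Rightarrow> nat \<Rightarrow> (nat \<Rightarrow> (real^'d) \<times> real) measure" where
  "marked_points n M N = PiM {..<N} (\<lambda>_.
      uniform_measure lborel (cbox (- (n/2) *\<^sub>R One) ((n/2) *\<^sub>R One)) \<Otimes>\<^sub>M M)"

text \<open>Probability of an event E (depending on the number N of points and on
  the configuration) under the marked homogeneous Poisson process of intensity 1 on the
  torus T_n of volume n^d: N is Poisson(n^d), and given N the points are i.i.d.
  uniform with i.i.d. marks.\<close>
definition ppp_prob :: "real \<Rightarrow> real measure \<Rightarrow>
    (nat \<Rightarrow> (nat \<Rightarrow> (real^'d) \<times> real) \<Rightarrow> bool) \<Rightarrow> real" where
  "ppp_prob n M E = (\<Sum>N. (n ^ CARD('d)) ^ N / fact N * exp (- (n ^ CARD('d))) *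
      measure (marked_points n M N) {\<omega> \<in> space (marked_points n M N). E N \<omega>})"

end

theory Submission
  imports Defs "HOL-Real_Asymp.Real_Asymp"
begin

text \<open>A path is at most twice as long as the sum of the marks of its vertices, and up to a constant
  per vertex this sum is the sum over dyadic scales j of 2^j times the number of vertices with mark
  exceeding 2^j.  Such points have density of order 2^(-js), so with high probability a sequence of
  them of total length l has at most O(log n + l 2^(-js/d)) members: this is a first moment bound over
  all sequences of points, with an exponential weight on the length.  As s > d, the factors
  2^j 2^(-js/d) are summable, hence the length of a path is at most a constant times its number of
  edges, plus half of itself, plus a term of order 2^J log n, where 2^J is the largest scale that
  occurs.  Since the largest mark is at most a power of n with exponent less than 1, a path
  joining points at distance of order n has linearly many edges.\<close>

subsection \<open>The toroidal distance and chains in a semimetric\<close>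

text \<open>A union bound over the paths themselves has to pay for a number of candidates that can
  grow exponentially with the number of edges, while one very long edge costs only a polynomially
  small probability. Scale by scale, only the event that a mark exceeds 2^j remains, and the weight
  exp(-t_j length) pays for the choice of positions. Integrating this weight over one point gives
  order (t_j n)^(-d), so each further point of a sequence contributes a factor of order n^d 2^(-js)
  (t_j n)^(-d). Up to a constant, t_j = 2^(-js/d) is the smallest choice that keeps this factor
  below 1/2 at all scales. The points of large mark on a path need not be adjacent, but by the
  triangle inequality they form a sequence no longer than the path. This is why arbitrary sequences
  of points are counted. The marks are cut off near n^\<gamma>: \<gamma> s > d keeps the maximum
  below the cut-off, and \<gamma> < 1 makes 2^J log n negligible. The estimates are made for a fixed
  number N \<le> 3 n^d of independent points; the Poisson average is taken at the end.\<close>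

lemma torus_dist_le:
  fixes x y z :: "real^'d"
  assumes "\<forall>i. z $ i \<in> \<int>"
  shows "torus_dist n x y \<le> norm (x - y - n *\<^sub>R z)"
  unfolding torus_dist_def using assms
  by (intro cInf_lower bdd_belowI[of _ 0]) auto

lemma torus_dist_greatest:
  fixes x y :: "real^'d"
  assumes "\<And>z. \<forall>i. z $ i \<in> \<int> \<Longrightarrow> c \<le> norm (x - y - n *\<^sub>R z)"
  shows "c \<le> torus_dist n x y"
  unfolding torus_dist_def using assms
  by (intro cInf_greatest) (auto intro: exI[of _ "0 :: real^'d"])

lemma torus_dist_approx:
  fixes x y :: "real^'d"
  assumes "torus_dist n x y < c"
  obtains z where "\<forall>i. z $ i \<in> \<int>" "norm (x - y - n *\<^sub>R z) < c"
  using assms torus_dist_greatest[of c x y n] by (meson not_le)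

lemma torus_dist_nonneg: "0 \<le> torus_dist n x y"
  by (rule torus_dist_greatest) simp

lemma torus_dist_le_norm: "torus_dist n x y \<le> norm (x - y)"
  using torus_dist_le[of 0 n x y] by simp

lemma torus_dist_commute: "torus_dist n x y = torus_dist n y x"
proof -
  have "torus_dist n x y \<le> torus_dist n y x" for x y :: "real^'d"
  proof (rule torus_dist_greatest)
    fix z :: "real^'d" assume "\<forall>i. z $ i \<in> \<int>"
    then show "torus_dist n x y \<le> norm (y - x - n *\<^sub>R z)"
      using torus_dist_le[of "-z" n x y] norm_minus_commute[of "x - y" "n *\<^sub>R (-z)"]
      by (simp add: norm_minus_commute algebra_simps)
  qed
  then show ?thesis by (meson antisym)
qed

lemma torus_dist_triangle:
  fixes x y z :: "real^'d"
  shows "torus_dist n x z \<le> torus_dist n x y + torus_dist n y z"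
proof -
  have "torus_dist n x z - torus_dist n y z \<le> torus_dist n x y"
  proof (rule torus_dist_greatest)
    fix u :: "real^'d" assume u: "\<forall>i. u $ i \<in> \<int>"
    have "torus_dist n x z - norm (x - y - n *\<^sub>R u) \<le> torus_dist n y z"
    proof (rule torus_dist_greatest)
      fix v :: "real^'d" assume v: "\<forall>i. v $ i \<in> \<int>"
      have "torus_dist n x z \<le> norm (x - z - n *\<^sub>R (u + v))"
        using u v by (intro torus_dist_le) auto
      also have "x - z - n *\<^sub>R (u + v) = (x - y - n *\<^sub>R u) + (y - z - n *\<^sub>R v)"
        by (simp add: algebra_simps)
      also have "norm \<dots> \<le> norm (x - y - n *\<^sub>R u) + norm (y - z - n *\<^sub>R v)"
        by (rule norm_triangle_ineq)
      finally show "torus_dist n x z - norm (x - y - n *\<^sub>R u) \<le> norm (y - z - n *\<^sub>R v)"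
        by simp
    qed
    then show "torus_dist n x z - torus_dist n y z \<le> norm (x - y - n *\<^sub>R u)" by simp
  qed
  then show ?thesis by simp
qed

text \<open>By the triangle inequality this function is 1-Lipschitz. Since the distance depends only
  on the difference of its arguments, joint measurability reduces to this function of one
  variable.\<close>

lemma continuous_on_torus_dist_diff: "continuous_on UNIV (\<lambda>w :: real^'d. torus_dist n w 0)"
proof (rule continuous_onI)
  fix x :: "real^'d" and e :: real assume e: "0 < e"
  have "dist (torus_dist n y 0) (torus_dist n x 0) \<le> e" if "dist y x < e" for y
    using torus_dist_triangle[of n x 0 y] torus_dist_triangle[of n y 0 x]
      torus_dist_le_norm[of n x y] torus_dist_le_norm[of n y x] that
    by (simp add: dist_norm norm_minus_commute)
  with e show "\<exists>d>0. \<forall>x'\<in>UNIV. dist x' x < d \<longrightarrow> dist (torus_dist n x' 0) (torus_dist n x 0) \<le> e"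
    by blast
qed

lemma borel_measurable_torus_dist [measurable (raw)]:
  fixes f g :: "'a \<Rightarrow> real^'d"
  assumes [measurable]: "f \<in> borel_measurable M" "g \<in> borel_measurable M"
  shows "(\<lambda>x. torus_dist n (f x) (g x)) \<in> borel_measurable M"
proof -
  have [measurable]: "(\<lambda>w :: real^'d. torus_dist n w 0) \<in> borel_measurable borel"
    by (rule borel_measurable_continuous_onI) (rule continuous_on_torus_dist_diff)
  have "torus_dist n x y = torus_dist n (x - y) 0" for x y :: "real^'d"
    by (simp add: torus_dist_def)
  then have "(\<lambda>x. torus_dist n (f x) (g x)) = (\<lambda>x. torus_dist n (f x - g x) 0)"
    by auto
  then show ?thesis by simp
qed

text \<open>In the coordinate \<open>i0\<close> every translate of the difference equals -(n/2) (1 +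
  2k) with an integer k, and an odd integer has absolute value at least 1.\<close>

lemma torus_dist_axis:
  fixes i0 :: "'d::finite"
  assumes "0 \<le> n"
  shows "n / 2 \<le> torus_dist n (- (n / 4) *\<^sub>R axis i0 1) ((n / 4) *\<^sub>R (axis i0 1 :: real^'d))"
proof (rule torus_dist_greatest)
  fix z :: "real^'d" assume "\<forall>i. z $ i \<in> \<int>"
  then obtain k where k: "z $ i0 = of_int k" by (meson Ints_cases)
  have "1 \<le> \<bar>1 + 2 * k\<bar>" by presburger
  then have "1 \<le> \<bar>1 + 2 * real_of_int k\<bar>" by linarith
  then have "n / 2 * 1 \<le> n / 2 * \<bar>1 + 2 * real_of_int k\<bar>"
    using assms by (intro mult_left_mono) auto
  also have "\<dots> = \<bar>n / 2 * (1 + 2 * real_of_int k)\<bar>" using assms by (simp add: abs_mult)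
  also have "\<dots> = \<bar>- (n / 4) - n / 4 - n * of_int k\<bar>" by (simp add: algebra_simps)
  also have "\<dots> = \<bar>(- (n / 4) *\<^sub>R axis i0 1 - (n / 4) *\<^sub>R axis i0 1 - n *\<^sub>R z) $ i0\<bar>"
    by (simp add: k)
  also have "\<dots> \<le> norm (- (n / 4) *\<^sub>R axis i0 1 - (n / 4) *\<^sub>R axis i0 1 - n *\<^sub>R z)"
    by (rule component_le_norm_cart)
  finally show "n / 2 \<le> norm (- (n / 4) *\<^sub>R axis i0 1 - (n / 4) *\<^sub>R axis i0 1 - n *\<^sub>R z)"
    by simp
qed

section \<open>Lengths of chains and the deterministic multiscale bound\<close>

fun chain_length :: "('a \<Rightarrow> 'a \<Rightarrow> real) \<Rightarrow> 'a list \<Rightarrow> real" where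
  "chain_length D (x # y # xs) = D x y + chain_length D (y # xs)"
| "chain_length D xs = 0"

text \<open>The elements will be indices of points, and different indices may carry the same
  position, so distance 0 between distinct elements has to be allowed.\<close>

locale semimetric =
  fixes D :: "'a \<Rightarrow> 'a \<Rightarrow> real"
  assumes nonneg: "0 \<le> D x y"
    and refl: "D x x = 0"
    and triangle: "D x z \<le> D x y + D y z"
begin

lemma chain_length_nonneg: "0 \<le> chain_length D xs"
proof (induction xs)
  case (Cons x xs)
  then show ?case by (cases xs) (auto simp: nonneg)
qed simp

lemma chain_length_tl_le: "chain_length D (x # ys) \<le> D x y + chain_length D (y # ys)"
proof (cases ys)
  case (Cons z zs)
  then show ?thesis using triangle[of x z y] by simp
qed (simp add: nonneg)

lemma chain_length_Cons_filter_le: "chain_length D (x # filter P xs) \<le> chain_length D (x # xs)"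
proof (induction xs arbitrary: x)
  case (Cons y ys)
  show ?case
  proof (cases "P y")
    case True
    with Cons[of y] show ?thesis by simp
  next
    case False
    with Cons[of x] chain_length_tl_le[of x ys y] show ?thesis by simp
  qed
qed simp

text \<open>Dropping an inner element shortens the chain by the triangle inequality, and dropping
  the first one removes a nonnegative term. It lets the length of a path control the chain of its
  vertices with large mark.\<close>

lemma chain_length_filter_le: "chain_length D (filter P xs) \<le> chain_length D xs"
proof (induction xs)
  case (Cons x xs)
  show ?case
  proof (cases "P x")
    case True
    with chain_length_Cons_filter_le[of x P xs] show ?thesis by simp
  next
    case False
    moreover have "chain_length D xs \<le> chain_length D (x # xs)"
      using nonneg by (cases xs) auto
    ultimately show ?thesis using Cons by simp
  qed
qed simp

lemma dist_hd_last_le: "xs \<noteq> [] \<Longrightarrow> D (hd xs) (last xs) \<le> chain_length D xs"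
proof (induction xs)
  case (Cons x xs)
  show ?case
  proof (cases xs)
    case (Cons y ys)
    with Cons.IH triangle[of x "last xs" y] show ?thesis by auto
  qed (simp add: refl)
qed simp

text \<open>Each vertex is charged by at most its two incident edges.\<close>

lemma chain_length_le_sum_list:
  fixes \<rho> :: "'a \<Rightarrow> real"
  assumes "successively (\<lambda>x y. D x y \<le> \<rho> x + \<rho> y) xs" "\<And>x. 0 \<le> \<rho> x"
  shows "chain_length D xs \<le> 2 * (\<Sum>x\<leftarrow>xs. \<rho> x)"
proof -
  \<comment> \<open>The first vertex pays for one edge only; keeping its spare
    \<open>\<rho> x\<close> on the left is what the induction needs when an edge is put in front of
    it.\<close>
  have "chain_length D (x # xs) + \<rho> x \<le> 2 * (\<Sum>y\<leftarrow>x # xs. \<rho> y)"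
    if "successively (\<lambda>x y. D x y \<le> \<rho> x + \<rho> y) (x # xs)" for x xs
    using that
  proof (induction xs arbitrary: x)
    case Nil
    with assms(2)[of x] show ?case by simp
  next
    case (Cons y ys)
    from Cons.IH[of y] Cons.prems show ?case by simp
  qed
  note * = this
  show ?thesis
  proof (cases xs)
    case (Cons y ys)
    with *[of y ys] assms(1) assms(2)[of y] show ?thesis by simp
  qed simp
qed

end

lemma layer_cake_powers_of_2:
  fixes r :: real
  assumes "r \<le> 2 ^ Suc J" "j0 \<le> Suc J"
  shows "r \<le> 2 ^ j0 + (\<Sum>j=j0..J. 2 ^ j * of_bool (2 ^ j < r))"
  using assms
proof (induction J)
  case 0
  then show ?case by (cases j0) auto
next
  case (Suc J)
  show ?case
  proof (cases "j0 = Suc (Suc J)")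
    case True
    with Suc.prems show ?thesis by simp
  next
    case False
    with Suc.prems have le: "j0 \<le> Suc J" by simp
    show ?thesis
    proof (cases "r \<le> 2 ^ Suc J")
      case True
      with Suc.IH le have "r \<le> 2 ^ j0 + (\<Sum>j=j0..J. 2 ^ j * of_bool (2 ^ j < r))" by simp
      with le True show ?thesis by simp
    next
      case False
      have "(\<Sum>j=j0..Suc J. 2 ^ j * of_bool (2 ^ j < r)) = (\<Sum>j=j0..Suc J. 2 ^ j :: real)"
      proof (rule sum.cong)
        fix j assume "j \<in> {j0..Suc J}"
        then have "(2 :: real) ^ j \<le> 2 ^ Suc J" by (intro power_increasing) auto
        with False have "2 ^ j < r" by linarith
        then show "2 ^ j * of_bool (2 ^ j < r) = (2 ^ j :: real)" by simp
      qed simp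
      also have "\<dots> = 2 ^ Suc (Suc J) - 2 ^ j0"
        using le by (induction rule: dec_induct) (auto simp: sum.atLeast_Suc_atMost)
      finally show ?thesis using Suc.prems by simp
    qed
  qed
qed

text \<open>A return to the starting vertex is cut out as a loop. Distinct vertices are essential
  later, since only distinct indices carry independent points.\<close>

lemma relpow_imp_distinct_path:
  assumes "(x, y) \<in> R ^^ k"
  obtains vs where "vs \<noteq> []" "distinct vs" "hd vs = x" "last vs = y"
    "successively (\<lambda>u v. (u, v) \<in> R) vs" "length vs \<le> Suc k"
proof -
  have "\<exists>vs. vs \<noteq> [] \<and> distinct vs \<and> hd vs = x \<and> last vs = y \<and>
    successively (\<lambda>u v. (u, v) \<in> R) vs \<and> length vs \<le> Suc k"
    using assms
  proof (induction k arbitrary: x)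
    case 0
    then show ?case by (intro exI[of _ "[x]"]) auto
  next
    case (Suc k)
    then obtain m where "(x, m) \<in> R" "(m, y) \<in> R ^^ k" by (meson relpow_Suc_D2)
    with Suc.IH obtain vs where vs: "vs \<noteq> []" "distinct vs" "hd vs = m" "last vs = y"
      "successively (\<lambda>u v. (u, v) \<in> R) vs" "length vs \<le> Suc k" by blast
    show ?case
    proof (cases "x \<in> set vs")
      case True
      then obtain us ws where "vs = us @ x # ws" by (meson split_list)
      with vs show ?thesis
        by (intro exI[of _ "x # ws"]) (auto simp: successively_append_iff)
    next
      case False
      with vs \<open>(x, m) \<in> R\<close> show ?thesis
        by (intro exI[of _ "x # vs"]) (auto simp: successively_Cons)
    qed
  qed
  with that show ?thesis by blast
qed

text \<open>The length L occurs on both sides: summing over the scales gives L \<le> 2 (2^j0 k + 2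
  2^J (1 + b) + L/4) for k vertices. Absorbing L/2 on the left doubles the rest, whence the
  constants 4 and 8.\<close>

lemma (in semimetric) chain_length_le_of_scales:
  fixes r :: "'a \<Rightarrow> real" and t :: "nat \<Rightarrow> real" and b :: real
  assumes succ: "successively (\<lambda>x y. D x y \<le> r x \<or> D x y \<le> r y) vs"
    and r_le: "\<And>x. x \<in> set vs \<Longrightarrow> r x \<le> 2 ^ Suc J" and j0: "j0 \<le> Suc J"
    and b: "(0 :: real) \<le> b"
    and t: "(\<Sum>j=j0..J. 2 ^ j * t j) \<le> 1 / 4" "\<And>j. 0 \<le> t j"
    and sparse: "\<And>j. j0 \<le> j \<Longrightarrow> j \<le> J \<Longrightarrow> filter (\<lambda>x. 2 ^ j < r x) vs \<noteq> [] \<Longrightarrow>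
      real (length (filter (\<lambda>x. 2 ^ j < r x) vs)) \<le> 1 + b +
        t j * chain_length D (filter (\<lambda>x. 2 ^ j < r x) vs)"
  shows "chain_length D vs \<le> 4 * 2 ^ j0 * length vs + 8 * 2 ^ J * (1 + b)"
proof -
  \<comment> \<open>This dyadic majorant of \<open>r\<close> on the chain is nonnegative everywhere,
    also where \<open>r\<close> is negative.\<close>
  define \<rho> :: "'a \<Rightarrow> real" where "\<rho> x = 2 ^ j0 + (\<Sum>j=j0..J. 2 ^ j * of_bool (2 ^ j < r x))" for x
  define L where "L = chain_length D vs"
  have \<rho>_nonneg: "0 \<le> \<rho> x" for x unfolding \<rho>_def by (intro add_nonneg_nonneg sum_nonneg) auto
  have r_\<rho>: "r x \<le> \<rho> x" if "x \<in> set vs" for x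
    unfolding \<rho>_def using layer_cake_powers_of_2[OF r_le[OF that] j0] .
  have "successively (\<lambda>x y. D x y \<le> \<rho> x + \<rho> y) vs"
    using succ
  proof (rule successively_mono)
    fix x y assume "x \<in> set vs" "y \<in> set vs" "D x y \<le> r x \<or> D x y \<le> r y"
    then show "D x y \<le> \<rho> x + \<rho> y"
      using r_\<rho>[of x] r_\<rho>[of y] \<rho>_nonneg[of x] \<rho>_nonneg[of y] by linarith
  qed
  then have "L \<le> 2 * (\<Sum>x\<leftarrow>vs. \<rho> x)"
    unfolding L_def using \<rho>_nonneg by (rule chain_length_le_sum_list)
  \<comment> \<open>Interchange of the sums over vertices and scales: scale j now counts the
    vertices above its threshold.\<close>
  also have "(\<Sum>x\<leftarrow>vs. \<rho> x) = 2 ^ j0 * length vs +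
      (\<Sum>j=j0..J. 2 ^ j * real (length (filter (\<lambda>x. 2 ^ j < r x) vs)))"
  proof (induction vs)
    case (Cons x xs)
    have "real (length (filter (\<lambda>x. 2 ^ j < r x) (x # xs))) =
        of_bool (2 ^ j < r x) + real (length (filter (\<lambda>x. 2 ^ j < r x) xs))" for j by simp
    then have "(\<Sum>j=j0..J. 2 ^ j * real (length (filter (\<lambda>x. 2 ^ j < r x) (x # xs)))) =
        (\<Sum>j=j0..J. 2 ^ j * of_bool (2 ^ j < r x)) +
        (\<Sum>j=j0..J. 2 ^ j * real (length (filter (\<lambda>x. 2 ^ j < r x) xs)))"
      by (simp only: distrib_left sum.distrib)
    with Cons show ?case unfolding \<rho>_def by (simp only: list.map sum_list.Cons) (simp add: algebra_simps)
  qed simp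
  also have "(\<Sum>j=j0..J. 2 ^ j * real (length (filter (\<lambda>x. 2 ^ j < r x) vs)))
      \<le> (\<Sum>j=j0..J. 2 ^ j * (1 + b + t j * L))"
  proof (intro sum_mono mult_left_mono)
    fix j assume j: "j \<in> {j0..J}"
    show "real (length (filter (\<lambda>x. 2 ^ j < r x) vs)) \<le> 1 + b + t j * L"
    proof (cases "filter (\<lambda>x. 2 ^ j < r x) vs = []")
      case True
      then show ?thesis using b t(2)[of j] chain_length_nonneg[of vs] unfolding L_def True by simp
    next
      case False
      with j have "real (length (filter (\<lambda>x. 2 ^ j < r x) vs)) \<le> 1 + b +
        t j * chain_length D (filter (\<lambda>x. 2 ^ j < r x) vs)" by (intro sparse) auto
      also have "\<dots> \<le> 1 + b + t j * L"
        unfolding L_def by (intro add_left_mono mult_left_mono chain_length_filter_le t)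
      finally show ?thesis .
    qed
  qed simp
  also have "\<dots> = (1 + b) * (\<Sum>j=j0..J. 2 ^ j) + L * (\<Sum>j=j0..J. 2 ^ j * t j)"
    by (simp add: algebra_simps sum.distrib sum_distrib_left)
  also have "(1 + b) * (\<Sum>j=j0..J. 2 ^ j) \<le> (1 + b) * (2 * 2 ^ J)"
  proof (rule mult_left_mono)
    have "(\<Sum>j=j0..J. 2 ^ j :: real) \<le> (\<Sum>j\<le>J. 2 ^ j)" by (intro sum_mono2) auto
    also have "\<dots> \<le> 2 * 2 ^ J" by (induction J) auto
    finally show "(\<Sum>j=j0..J. 2 ^ j :: real) \<le> 2 * 2 ^ J" .
  qed (use b in simp)
  also have "L * (\<Sum>j=j0..J. 2 ^ j * t j) \<le> L * (1 / 4)"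
    using t chain_length_nonneg[of vs] by (intro mult_left_mono) (auto simp: L_def)
  finally show ?thesis using b unfolding L_def by (simp add: algebra_simps)
qed

subsection \<open>Moment bounds for independent marked points\<close>

abbreviation torus_cube :: "real \<Rightarrow> (real^'d) set" where
  "torus_cube n \<equiv> cbox (- (n/2) *\<^sub>R One) ((n/2) *\<^sub>R One)"

abbreviation torus_uniform :: "real \<Rightarrow> (real^'d) measure" where
  "torus_uniform n \<equiv> uniform_measure lborel (torus_cube n)"

lemma emeasure_torus_cube:
  fixes n :: real
  assumes "0 \<le> n"
  shows "emeasure lborel (torus_cube n :: (real^'d) set) = ennreal (n ^ CARD('d))"
proof -
  have "\<And>b :: real^'d. b \<in> Basis \<Longrightarrow> ((n/2) *\<^sub>R One - - (n/2) *\<^sub>R One) \<bullet> b = n"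
    by (simp only: inner_diff_left inner_minus_left inner_scaleR_left inner_sum_Basis)
  moreover from this have "\<forall>b\<in>(Basis :: (real^'d) set). (- (n/2) *\<^sub>R One) \<bullet> b \<le> ((n/2) *\<^sub>R One) \<bullet> b"
    using assms by auto
  moreover from calculation(1) have
    "(\<Prod>b\<in>(Basis :: (real^'d) set). ((n/2) *\<^sub>R One - - (n/2) *\<^sub>R One) \<bullet> b) = n ^ CARD('d)"
    by (subst prod.cong[OF refl, of _ _ "\<lambda>_. n"]) auto
  ultimately show ?thesis unfolding emeasure_lborel_cbox_eq by - (subst if_P, assumption, simp only:)
qed

lemma emeasure_torus_uniform:
  assumes "0 \<le> n" "B \<in> sets borel"
  shows "emeasure (torus_uniform n :: (real^'d) measure) B =
    emeasure lborel (torus_cube n \<inter> B) / ennreal (n ^ CARD('d))"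
  using assms by (subst emeasure_uniform_measure; (subst emeasure_torus_cube)?) auto

lemma prob_space_torus_uniform: "0 < n \<Longrightarrow> prob_space (torus_uniform n :: (real^'d) measure)"
  by (rule prob_space_uniform_measure; subst emeasure_torus_cube) auto

lemma mem_torus_cube: "y \<in> torus_cube n \<longleftrightarrow> (\<forall>i. \<bar>y $ i\<bar> \<le> n / 2)"
proof -
  have "One $ i = (1 :: real)" for i :: 'a
  proof -
    have "One $ i = (One :: real^'a) \<bullet> axis i 1" by (simp add: inner_axis)
    also have "\<dots> = 1" by (rule inner_sum_Basis) (simp add: axis_in_Basis_iff)
    finally show ?thesis .
  qed
  then have "y \<in> torus_cube n \<longleftrightarrow> (\<forall>i. - (n / 2) \<le> y $ i \<and> y $ i \<le> n / 2)"
    by (simp add: mem_box_cart)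
  also have "\<dots> \<longleftrightarrow> (\<forall>i. \<bar>y $ i\<bar> \<le> n / 2)" by (simp only: abs_le_iff minus_le_iff conj_commute)
  finally show ?thesis .
qed

text \<open>These offsets lead to the cube itself and its neighbours in the tiling by translates;
  their number enters the estimates only as a constant.\<close>

definition unit_offsets :: "(real^'d) set" where
  "unit_offsets = {e. \<forall>i. e $ i \<in> {-1, 0, 1}}"

lemma finite_unit_offsets: "finite (unit_offsets :: (real^'d) set)"
proof -
  have "(unit_offsets :: (real^'d) set) \<subseteq> (\<lambda>f. \<chi> i. f i) ` (UNIV \<rightarrow>\<^sub>E {-1, 0, 1 :: real})"
  proof
    fix e :: "real^'d" assume "e \<in> unit_offsets"
    then show "e \<in> (\<lambda>f. \<chi> i. f i) ` (UNIV \<rightarrow>\<^sub>E {-1, 0, 1 :: real})"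
      by (intro image_eqI[of _ _ "($) e"]) (auto simp: unit_offsets_def PiE_def)
  qed
  then show ?thesis by (rule finite_subset) (intro finite_imageI finite_PiE; simp)
qed

text \<open>Replacing x by its representative in the cube, the coordinates of the difference to a
  point of the cube are at most n in absolute value; clamping the integer translation vector to
  coordinates in {-1, 0, 1} then does not increase the norm.\<close>
lemma torus_ball_cover:
  fixes x :: "real^'d"
  assumes n: "0 < n"
  obtains c where
    "\<And>y r. y \<in> torus_cube n \<Longrightarrow> torus_dist n x y < r \<Longrightarrow> \<exists>e\<in>unit_offsets. y \<in> cball (c + n *\<^sub>R e) r"
proof -
  define z0 :: "real^'d" where "z0 = (\<chi> i. of_int (round (x $ i / n)))"
  have z0: "\<bar>x $ i - n * z0 $ i\<bar> \<le> n / 2" for i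
  proof -
    have "\<bar>of_int (round (x $ i / n)) - x $ i / n\<bar> \<le> 1 / 2" by (rule of_int_round_abs_le)
    then have "n * \<bar>of_int (round (x $ i / n)) - x $ i / n\<bar> \<le> n * (1 / 2)"
      using n by (intro mult_left_mono) auto
    also have "n * \<bar>of_int (round (x $ i / n)) - x $ i / n\<bar> = \<bar>n * (of_int (round (x $ i / n)) - x $ i / n)\<bar>"
      using n by (simp add: abs_mult)
    also have "n * (of_int (round (x $ i / n)) - x $ i / n) = n * z0 $ i - x $ i"
      using n by (simp add: z0_def algebra_simps)
    finally show ?thesis by (simp add: abs_minus_commute)
  qed
  show thesis
  proof (rule that[of "x - n *\<^sub>R z0"])
    fix y :: "real^'d" and r assume y: "y \<in> torus_cube n" and "torus_dist n x y < r"
    then obtain z :: "real^'d" where z: "\<forall>i. z $ i \<in> \<int>" and less: "norm (x - y - n *\<^sub>R z) < r"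
      using torus_dist_approx by metis
    define e :: "real^'d" where "e = (\<chi> i. - max (-1) (min 1 (z $ i - z0 $ i)))"
    have int: "z $ i - z0 $ i \<in> \<int>" for i using z by (auto simp: z0_def)
    have "- e $ i \<in> {-1, 0, 1}" and
      "\<bar>(x $ i - y $ i - n * z0 $ i) - n * (- e $ i)\<bar> \<le>
       \<bar>(x $ i - y $ i - n * z0 $ i) - n * (z $ i - z0 $ i)\<bar>" for i
    proof -
      obtain k where k: "z $ i - z0 $ i = of_int k" using int[of i] by (meson Ints_cases)
      define a where "a = x $ i - y $ i - n * z0 $ i"
      have a: "\<bar>a\<bar> \<le> n" using z0[of i] y unfolding mem_torus_cube a_def by (smt (verit) field_sum_of_halves)
      \<comment> \<open>For |a| \<le> n, the value |a - n k| grows as k moves up from 1 or down from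
        -1, so clamping k to these values cannot increase it.\<close>
      consider "k \<ge> 1" | "k = 0" | "k \<le> -1" by linarith
      then have "- e $ i \<in> {-1, 0, 1} \<and> \<bar>a - n * (- e $ i)\<bar> \<le> \<bar>a - n * (z $ i - z0 $ i)\<bar>"
      proof cases
        case 1
        then have "- e $ i = 1" by (simp add: e_def k)
        moreover have "n * 1 \<le> n * (z $ i - z0 $ i)"
          using n 1 unfolding k by (intro mult_left_mono) auto
        ultimately show ?thesis using a by auto
      next
        case 2
        then show ?thesis by (simp add: e_def k)
      next
        case 3
        then have "- e $ i = - 1" by (simp add: e_def k)
        moreover have "n * (z $ i - z0 $ i) \<le> n * (-1)"
          using n 3 unfolding k by (intro mult_left_mono) auto
        ultimately show ?thesis using a by auto
      qed
      then show "- e $ i \<in> {-1, 0, 1}"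
        "\<bar>(x $ i - y $ i - n * z0 $ i) - n * (- e $ i)\<bar> \<le>
         \<bar>(x $ i - y $ i - n * z0 $ i) - n * (z $ i - z0 $ i)\<bar>" by (auto simp: a_def)
    qed
    note e = this
    have "norm (x - n *\<^sub>R z0 + n *\<^sub>R e - y) \<le> norm (x - y - n *\<^sub>R z)"
    proof (rule norm_le_componentwise_cart)
      fix i show "norm ((x - n *\<^sub>R z0 + n *\<^sub>R e - y) $ i) \<le> norm ((x - y - n *\<^sub>R z) $ i)"
        using e(2)[of i] by (simp add: algebra_simps)
    qed
    moreover have "e \<in> unit_offsets"
      unfolding unit_offsets_def using e(1) by (force simp: minus_equation_iff)
    ultimately show "\<exists>e\<in>unit_offsets. y \<in> cball ((x - n *\<^sub>R z0) + n *\<^sub>R e) r"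
      using less by (intro bexI[of _ e]) (auto simp: dist_norm)
  qed
qed

text \<open>The bound covers every positive radius, also beyond the size of the torus, so the
  summation over shells below needs no cut-off.\<close>

lemma emeasure_torus_ball_le:
  fixes x :: "real^'d"
  assumes n: "0 < n" and r: "0 < r"
  shows "emeasure (torus_uniform n) {y. torus_dist n x y < r} \<le>
    ennreal (card (unit_offsets :: (real^'d) set) * unit_ball_vol CARD('d) * (r / n) ^ CARD('d))"
proof -
  obtain c where c: "\<And>y r. y \<in> torus_cube n \<Longrightarrow> torus_dist n x y < r \<Longrightarrow>
      \<exists>e\<in>unit_offsets. y \<in> cball (c + n *\<^sub>R e) r"
    using torus_ball_cover[OF n] by metis
  have [measurable]: "{y. torus_dist n x y < r} \<in> sets borel" by measurable
  have "emeasure lborel (torus_cube n \<inter> {y. torus_dist n x y < r}) \<le>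
      emeasure lborel (\<Union>e\<in>unit_offsets. cball (c + n *\<^sub>R e) r)"
    using c by (intro emeasure_mono) (auto simp: finite_unit_offsets intro!: borel_closed closed_UN)
  also have "\<dots> \<le> (\<Sum>e\<in>unit_offsets. emeasure lborel (cball (c + n *\<^sub>R e) r))"
    by (intro emeasure_subadditive_finite finite_unit_offsets) auto
  also have "\<dots> = ennreal (card (unit_offsets :: (real^'d) set) * (unit_ball_vol CARD('d) * r ^ CARD('d)))"
    using r by (simp add: emeasure_cball ennreal_mult' ennreal_of_nat_eq_real_of_nat)
  finally have "emeasure (torus_uniform n) {y. torus_dist n x y < r} \<le>
     ennreal (card (unit_offsets :: (real^'d) set) * (unit_ball_vol CARD('d) * r ^ CARD('d))) / ennreal (n ^ CARD('d))"
    using n by (subst emeasure_torus_uniform) (auto intro: divide_right_mono_ennreal)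
  also have "\<dots> = ennreal (card (unit_offsets :: (real^'d) set) * unit_ball_vol CARD('d) * (r / n) ^ CARD('d))"
    using n r by (simp add: divide_ennreal power_divide)
  finally show ?thesis .
qed

text \<open>Sort the points by the integer part k of t times the distance: the weight is at most
  exp(-k), and the ball of radius (k + 2)/t has probability of order (k + 2)^d / (t n)^d. The series
  in k converges, and its sum depends on the dimension only.\<close>

lemma nn_integral_exp_torus_dist_le:
  obtains C where "0 < C" "\<And>n t (x :: real^'d). 0 < n \<Longrightarrow> 0 < t \<Longrightarrow>
    (\<integral>\<^sup>+y. ennreal (exp (- t * torus_dist n y x)) \<partial>torus_uniform n) \<le> ennreal (C / (t * n) ^ CARD('d))"
proof -
  define d where "d = CARD('d)"
  define A where "A = card (unit_offsets :: (real^'d) set) * unit_ball_vol d"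
  define f where "f k = exp (- real k) * (real k + 2) ^ d" for k
  have A: "0 \<le> A" by (simp add: A_def)
  have f: "0 \<le> f k" for k by (simp add: f_def)
  have "summable f"
  proof (rule summable_comparison_test')
    show "summable (\<lambda>k. fact d * 2 ^ d * exp 1 * exp (- 1 / 2 :: real) ^ k)"
      by (intro summable_mult summable_geometric) auto
    fix k :: nat
    \<comment> \<open>A single term of the exponential series dominates the power. Halving k leaves
      the summable ratio exp(-1/2) after multiplication by exp(-k).\<close>
    have "(real k / 2 + 1) ^ d \<le> fact d * exp (real k / 2 + 1)"
    proof -
      have "(\<lambda>m. (real k / 2 + 1) ^ m / fact m) sums exp (real k / 2 + 1)"
        using exp_converges[of "real k / 2 + 1"] by (simp add: field_simps)
      then have "(\<Sum>m\<in>{d}. (real k / 2 + 1) ^ m / fact m) \<le> exp (real k / 2 + 1)"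
        by (subst sums_unique, assumption) (intro sum_le_suminf; auto simp: sums_iff)
      then show ?thesis by (simp add: field_simps)
    qed
    moreover have "(real k + 2) ^ d = 2 ^ d * (real k / 2 + 1) ^ d"
      by (simp flip: power_mult_distrib add: algebra_simps)
    ultimately have "f k \<le> exp (- real k) * (2 ^ d * (fact d * exp (real k / 2 + 1)))"
      unfolding f_def by (simp add: mult_left_mono)
    also have "\<dots> = fact d * 2 ^ d * exp 1 * exp (- 1 / 2) ^ k"
      by (simp add: exp_add exp_minus field_simps flip: exp_of_nat_mult exp_add)
    finally show "norm (f k) \<le> fact d * 2 ^ d * exp 1 * exp (- 1 / 2) ^ k" using f by simp
  qed
  show thesis
  proof (rule that[of "A * suminf f + 1"])
    show "0 < A * suminf f + 1" using A f \<open>summable f\<close> by (simp add: add_nonneg_pos suminf_nonneg)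
    fix n t :: real and x :: "real^'d" assume n: "0 < n" and t: "0 < t"
    have meas: "{y. torus_dist n x y < (real k + 2) / t} \<in> sets (torus_uniform n)" for k
      by measurable
    have "(\<integral>\<^sup>+y. ennreal (exp (- t * torus_dist n y x)) \<partial>torus_uniform n) \<le>
      (\<integral>\<^sup>+y. (\<Sum>k. ennreal (exp (- real k)) * indicator {y. torus_dist n x y < (real k + 2) / t} y) \<partial>torus_uniform n)"
    proof (rule nn_integral_mono)
      fix y :: "real^'d"
      define k where "k = nat \<lfloor>t * torus_dist n x y\<rfloor>"
      have "0 \<le> t * torus_dist n x y" using t by (simp add: torus_dist_nonneg)
      then have k: "real k \<le> t * torus_dist n x y" "t * torus_dist n x y < real k + 1"
        unfolding k_def by linarith+
      then have "torus_dist n x y < (real k + 2) / t" using t by (simp add: field_simps)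
      then have "ennreal (exp (- t * torus_dist n y x)) \<le>
          (\<Sum>k\<in>{k}. ennreal (exp (- real k)) * indicator {y. torus_dist n x y < (real k + 2) / t} y)"
        using k by (simp add: torus_dist_commute[of n y x] ennreal_leI)
      also have "\<dots> \<le> (\<Sum>k. ennreal (exp (- real k)) * indicator {y. torus_dist n x y < (real k + 2) / t} y)"
        by (intro sum_le_suminf) auto
      finally show "ennreal (exp (- t * torus_dist n y x)) \<le> \<dots>" .
    qed
    also have "\<dots> = (\<Sum>k. ennreal (exp (- real k)) * emeasure (torus_uniform n) {y. torus_dist n x y < (real k + 2) / t})"
      using meas by (subst nn_integral_suminf) (auto simp: nn_integral_cmult_indicator)
    also have "\<dots> \<le> (\<Sum>k. ennreal (A / (t * n) ^ d * f k))"
    proof (intro suminf_le summableI)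
      fix k
      have "ennreal (exp (- real k)) * emeasure (torus_uniform n) {y. torus_dist n x y < (real k + 2) / t}
        \<le> ennreal (exp (- real k)) * ennreal (A * ((real k + 2) / t / n) ^ d)"
        unfolding A_def d_def using n t by (intro mult_left_mono emeasure_torus_ball_le) auto
      also have "\<dots> = ennreal (A / (t * n) ^ d * f k)"
        by (subst ennreal_mult'[symmetric]) (auto simp: f_def power_divide power_mult_distrib field_simps)
      finally show "ennreal (exp (- real k)) * emeasure (torus_uniform n) {y. torus_dist n x y < (real k + 2) / t} \<le> \<dots>" .
    qed
    also have "\<dots> = ennreal (A / (t * n) ^ d * suminf f)"
      using \<open>summable f\<close> A f n t
      by (subst suminf_ennreal2) (auto simp: suminf_mult suminf_divide summable_mult intro!: summable_mult mult_nonneg_nonneg divide_nonneg_nonneg)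
    also have "\<dots> \<le> ennreal ((A * suminf f + 1) / (t * n) ^ d)"
      using n t by (intro ennreal_leI) (simp add: divide_right_mono)
    finally show "(\<integral>\<^sup>+y. ennreal (exp (- t * torus_dist n y x)) \<partial>torus_uniform n) \<le>
        ennreal ((A * suminf f + 1) / (t * n) ^ CARD('d))" by (simp add: d_def)
  qed
qed

section \<open>Multiplicative weights along chains of independent points\<close>

fun chain_weight :: "('a \<Rightarrow> 'a \<Rightarrow> ennreal) \<Rightarrow> ('a \<Rightarrow> ennreal) \<Rightarrow> 'a list \<Rightarrow> ennreal" where
  "chain_weight K W (x # y # xs) = K x y * chain_weight K W (y # xs)"
| "chain_weight K W [x] = W x"
| "chain_weight K W [] = 1"

lemma chain_weight_cong:
  assumes "\<And>x y. x \<in> set xs \<Longrightarrow> y \<in> set xs \<Longrightarrow> K x y = K' x y" "\<And>x. x \<in> set xs \<Longrightarrow> W x = W' x"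
  shows "chain_weight K W xs = chain_weight K' W' xs"
  using assms by (induction K W xs rule: chain_weight.induct) auto

lemma borel_measurable_chain_weight:
  assumes [measurable]: "case_prod K \<in> borel_measurable (\<mu> \<Otimes>\<^sub>M \<mu>)" "W \<in> borel_measurable \<mu>"
    and "set xs \<subseteq> I"
  shows "(\<lambda>\<omega>. chain_weight (\<lambda>i j. K (\<omega> i) (\<omega> j)) (\<lambda>i. W (\<omega> i)) xs) \<in> borel_measurable (Pi\<^sub>M I (\<lambda>_. \<mu>))"
  using assms(3)
proof (induction xs)
  case (Cons x xs)
  then have [measurable]: "x \<in> I" by simp
  show ?case
  proof (cases xs)
    case (Cons y ys)
    with Cons.prems have [measurable]: "y \<in> I" by simp
    note [measurable] = Cons.IH[unfolded Cons]
    have [measurable]: "(\<lambda>\<omega>. K (\<omega> x) (\<omega> y)) \<in> borel_measurable (Pi\<^sub>M I (\<lambda>_. \<mu>))"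
      by measurable
    show ?thesis unfolding Cons using Cons.IH Cons.prems Cons by auto
  qed simp
qed simp

text \<open>The head of the list occurs in a single factor, the kernel linking it to its successor.
  It is therefore integrated out first, at cost \<kappa> uniformly in the successor; repeating this
  leaves the weight of the last point.\<close>

lemma nn_integral_chain_weight_le:
  assumes "prob_space \<mu>"
    and K [measurable]: "case_prod K \<in> borel_measurable (\<mu> \<Otimes>\<^sub>M \<mu>)"
    and W [measurable]: "W \<in> borel_measurable \<mu>"
    and K_le: "\<And>v. v \<in> space \<mu> \<Longrightarrow> (\<integral>\<^sup>+u. K u v \<partial>\<mu>) \<le> \<kappa>"
    and W_le: "(\<integral>\<^sup>+u. W u \<partial>\<mu>) \<le> p"
    and "finite I" "set xs \<subseteq> I" "distinct xs" "xs \<noteq> []"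
  shows "(\<integral>\<^sup>+\<omega>. chain_weight (\<lambda>i j. K (\<omega> i) (\<omega> j)) (\<lambda>i. W (\<omega> i)) xs \<partial>Pi\<^sub>M I (\<lambda>_. \<mu>)) \<le>
    \<kappa> ^ (length xs - 1) * p"
  using assms(6-)
proof (induction xs arbitrary: I)
  case (Cons x xs)
  interpret \<mu>: prob_space \<mu> by fact
  interpret P: product_prob_space "\<lambda>_. \<mu>" ..
  define J where "J = I - {x}"
  have I: "I = insert x J" "finite J" "x \<notin> J" "set xs \<subseteq> J" using Cons.prems by (auto simp: J_def)
  interpret J: finite_product_prob_space "\<lambda>_. \<mu>" J
    by standard (fact I)
  let ?c = "\<lambda>xs \<omega>. chain_weight (\<lambda>i j. K (\<omega> i) (\<omega> j)) (\<lambda>i. W (\<omega> i)) xs"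
  have meas: "?c (x # xs) \<in> borel_measurable (Pi\<^sub>M (insert x J) (\<lambda>_. \<mu>))"
    using borel_measurable_chain_weight[OF K W Cons.prems(2)] I by simp
  have "(\<integral>\<^sup>+\<omega>. ?c (x # xs) \<omega> \<partial>Pi\<^sub>M I (\<lambda>_. \<mu>)) =
      (\<integral>\<^sup>+\<omega>. (\<integral>\<^sup>+u. ?c (x # xs) (fun_upd \<omega> x u) \<partial>\<mu>) \<partial>Pi\<^sub>M J (\<lambda>_. \<mu>))"
    unfolding I(1) using I meas by (intro P.product_nn_integral_insert) auto
  also have "\<dots> \<le> \<kappa> ^ (length (x # xs) - 1) * p"
  proof (cases xs)
    case Nil
    then show ?thesis using W_le by (simp add: J.emeasure_space_1)
  next
    case (Cons y ys)
    have ne: "y \<noteq> x" "y \<in> J" using I Cons by auto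
    have "(\<integral>\<^sup>+\<omega>. (\<integral>\<^sup>+u. ?c (x # xs) (fun_upd \<omega> x u) \<partial>\<mu>) \<partial>Pi\<^sub>M J (\<lambda>_. \<mu>)) \<le>
      (\<integral>\<^sup>+\<omega>. \<kappa> * ?c xs \<omega> \<partial>Pi\<^sub>M J (\<lambda>_. \<mu>))"
    proof (rule nn_integral_mono)
      fix \<omega> assume \<omega>: "\<omega> \<in> space (Pi\<^sub>M J (\<lambda>_. \<mu>))"
      then have \<omega>y [measurable]: "\<omega> y \<in> space \<mu>" using ne by (auto simp: space_PiM PiE_iff)
      \<comment> \<open>As the list is distinct, changing coordinate \<open>x\<close> does not
        affect the weight of the tail.\<close>
      have "?c (x # xs) (fun_upd \<omega> x u) = K u (\<omega> y) * ?c xs \<omega>" for u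
      proof -
        have "?c xs (fun_upd \<omega> x u) = ?c xs \<omega>"
          using I by (intro chain_weight_cong) auto
        then show ?thesis using ne by (simp add: Cons)
      qed
      then have "(\<integral>\<^sup>+u. ?c (x # xs) (fun_upd \<omega> x u) \<partial>\<mu>) = (\<integral>\<^sup>+u. K u (\<omega> y) \<partial>\<mu>) * ?c xs \<omega>"
        by (simp add: nn_integral_multc)
      also have "\<dots> \<le> \<kappa> * ?c xs \<omega>" using K_le[OF \<omega>y] by (intro mult_right_mono) auto
      finally show "(\<integral>\<^sup>+u. ?c (x # xs) (fun_upd \<omega> x u) \<partial>\<mu>) \<le> \<kappa> * ?c xs \<omega>" .
    qed
    also have "\<dots> = \<kappa> * (\<integral>\<^sup>+\<omega>. ?c xs \<omega> \<partial>Pi\<^sub>M J (\<lambda>_. \<mu>))"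
      using borel_measurable_chain_weight[OF K W I(4)] by (rule nn_integral_cmult)
    also have "\<dots> \<le> \<kappa> * (\<kappa> ^ (length xs - 1) * p)"
      using Cons.IH[of J] Cons.prems I Cons by (intro mult_left_mono) auto
    also have "\<dots> = \<kappa> ^ (length (x # xs) - 1) * p"
      by (simp add: Cons mult.assoc)
    finally show ?thesis .
  qed
  finally show ?case .
qed simp

text \<open>The factor e on each edge puts the number of points into the exponent, where it competes
  with t times the length. A chain has one edge fewer than points, hence the -1.\<close>

lemma chain_weight_exp:
  assumes "xs \<noteq> []" "\<And>x. x \<in> set xs \<Longrightarrow> P x"
  shows "chain_weight (\<lambda>x y. ennreal (exp (1 - t * D x y)) * indicator {x. P x} x) (indicator {x. P x}) xs =
    ennreal (exp (real (length xs) - 1 - t * chain_length D xs))"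
  using assms
proof (induction xs)
  case (Cons x xs)
  show ?case
  proof (cases xs)
    case (Cons y ys)
    then have "chain_weight (\<lambda>x y. ennreal (exp (1 - t * D x y)) * indicator {x. P x} x) (indicator {x. P x}) (x # xs) =
      ennreal (exp (1 - t * D x y)) * ennreal (exp (real (length xs) - 1 - t * chain_length D xs))"
      using Cons.IH Cons.prems by simp
    also have "\<dots> = ennreal (exp (real (length (x # xs)) - 1 - t * chain_length D (x # xs)))"
      using Cons by (simp add: ennreal_mult'[symmetric] algebra_simps flip: exp_add)
    finally show ?thesis .
  qed (use Cons.prems in simp)
qed simp

section \<open>First moments over configurations with a fixed number of points\<close>

lemma sets_marked_points [measurable_cong]:
  "sets (marked_points n M N) = sets (Pi\<^sub>M {..<N} (\<lambda>_. torus_uniform n \<Otimes>\<^sub>M M))"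
  by (simp add: marked_points_def)

lemma measurable_marked_points_components [measurable]:
  assumes "i < N" and "sets M = sets borel"
  shows "(\<lambda>\<omega>. fst (\<omega> i)) \<in> borel_measurable (marked_points n M N :: (nat \<Rightarrow> (real^'d) \<times> real) measure)"
    and "(\<lambda>\<omega>. snd (\<omega> i)) \<in> borel_measurable (marked_points n M N :: (nat \<Rightarrow> (real^'d) \<times> real) measure)"
proof -
  have [measurable]: "i \<in> {..<N}" using assms by simp
  note [measurable_cong] = assms(2)
  have *: "(\<lambda>\<omega>. fst (\<omega> i)) \<in> measurable (marked_points n M N) (torus_uniform n :: (real^'d) measure)"
    "(\<lambda>\<omega>. snd (\<omega> i)) \<in> measurable (marked_points n M N :: (nat \<Rightarrow> (real^'d) \<times> real) measure) M"
    by measurable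
  show "(\<lambda>\<omega>. fst (\<omega> i)) \<in> borel_measurable (marked_points n M N :: (nat \<Rightarrow> (real^'d) \<times> real) measure)"
    using *(1) by (simp cong: measurable_cong_sets)
  show "(\<lambda>\<omega>. snd (\<omega> i)) \<in> borel_measurable (marked_points n M N :: (nat \<Rightarrow> (real^'d) \<times> real) measure)"
    using *(2) assms(2) by (simp cong: measurable_cong_sets)
qed

context
  fixes M :: "real measure" and n :: real
  assumes M_prob: "prob_space M" and M_sets [measurable_cong]: "sets M = sets borel" and n: "0 < n"
begin

lemma prob_space_mark: "prob_space (torus_uniform n \<Otimes>\<^sub>M M :: ((real^'d) \<times> real) measure)"
  using prob_space_torus_uniform[OF n] M_prob by (rule prob_space_pair)

lemma prob_space_marked_points: "prob_space (marked_points n M N :: (nat \<Rightarrow> (real^'d) \<times> real) measure)"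
  unfolding marked_points_def using prob_space_mark by (intro prob_space_PiM)

lemma nn_integral_mark:
  assumes [measurable]: "f \<in> borel_measurable (borel :: (real^'d) measure)"
    "g \<in> borel_measurable (borel :: real measure)"
  shows "(\<integral>\<^sup>+u. f (fst u) * g (snd u) \<partial>(torus_uniform n \<Otimes>\<^sub>M M)) =
    (\<integral>\<^sup>+y. f y \<partial>torus_uniform n) * (\<integral>\<^sup>+r. g r \<partial>M)"
proof -
  interpret M: prob_space M by (rule M_prob)
  have "(\<integral>\<^sup>+u. f (fst u) * g (snd u) \<partial>(torus_uniform n \<Otimes>\<^sub>M M)) =
      (\<integral>\<^sup>+y. \<integral>\<^sup>+r. f (fst (y, r)) * g (snd (y, r)) \<partial>M \<partial>torus_uniform n)"
    by (rule M.nn_integral_fst[symmetric]) measurable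
  also have "\<dots> = (\<integral>\<^sup>+y. f y \<partial>torus_uniform n) * (\<integral>\<^sup>+r. g r \<partial>M)"
    by (simp add: nn_integral_cmult nn_integral_multc)
  finally show ?thesis .
qed

text \<open>A union bound over all sequences of points with marks exceeding h: the exponential Markov
  inequality replaces the event that such a sequence is too short by a chain weight.\<close>
lemma sparse_large_marks:
  fixes t h b q :: real and N :: nat
  assumes q: "\<And>x :: real^'d. (\<integral>\<^sup>+y. ennreal (exp (- t * torus_dist n y x)) \<partial>torus_uniform n) \<le> ennreal q"
      "0 \<le> q"
    and small: "exp 1 * measure M {h<..} * q * N \<le> 1 / 2"
  obtains F where "F \<in> borel_measurable (marked_points n M N :: (nat \<Rightarrow> (real^'d) \<times> real) measure)"
    "(\<integral>\<^sup>+\<omega>. F \<omega> \<partial>marked_points n M N) \<le> ennreal (2 * real N * exp (- b))"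
    "\<And>\<omega> xs. F \<omega> < 1 \<Longrightarrow> xs \<noteq> [] \<Longrightarrow> distinct xs \<Longrightarrow> set xs \<subseteq> {..<N} \<Longrightarrow>
      (\<And>i. i \<in> set xs \<Longrightarrow> h < snd (\<omega> i)) \<Longrightarrow>
      real (length xs) \<le> 1 + b + t * chain_length (\<lambda>i j. torus_dist n (fst (\<omega> i)) (fst (\<omega> j))) xs"
proof -
  interpret M: prob_space M by (rule M_prob)
  let ?\<mu> = "torus_uniform n \<Otimes>\<^sub>M M :: ((real^'d) \<times> real) measure"
  \<comment> \<open>The indicator sits on the first point of each pair, so that every point of the
    chain is tested exactly once, the last one by \<open>W\<close>.\<close>
  define K :: "(real^'d) \<times> real \<Rightarrow> (real^'d) \<times> real \<Rightarrow> ennreal" where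
    "K u v = ennreal (exp (1 - t * torus_dist n (fst u) (fst v))) * indicator {h<..} (snd u)" for u v
  define W :: "(real^'d) \<times> real \<Rightarrow> ennreal" where "W u = indicator {h<..} (snd u)" for u
  define c where "c xs \<omega> = chain_weight (\<lambda>i j. K (\<omega> i) (\<omega> j)) (\<lambda>i. W (\<omega> i)) xs"
    for xs :: "nat list" and \<omega>
  \<comment> \<open>Here m counts steps, so the lists have m + 1 points; distinctness forces m <
    N.\<close>
  define S where "S m = {xs. length xs = Suc m \<and> distinct xs \<and> set xs \<subseteq> {..<N}}" for m
  \<comment> \<open>The exceptional event is represented by a nonnegative function of small
    integral, with \<open>F \<omega> < 1\<close> as the good case. Such functions can be added over
    scales and kinds of failure, turning union bounds into additivity of the integral.\<close>
  define F where "F \<omega> = (\<Sum>m<N. \<Sum>xs\<in>S m. ennreal (exp (- b)) * c xs \<omega>)" for \<omega>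
  \<comment> \<open>The mean weight of one step. With N choices for each new point, the hypothesis
    \<open>small\<close> makes \<kappa> N at most 1/2, hence a geometric series.\<close>
  define \<kappa> where "\<kappa> = exp 1 * measure M {h<..} * q"
  have \<kappa>: "0 \<le> \<kappa>" using q by (simp add: \<kappa>_def)
  have K: "case_prod K \<in> borel_measurable (?\<mu> \<Otimes>\<^sub>M ?\<mu>)"
    unfolding K_def by measurable
  have W: "W \<in> borel_measurable ?\<mu>"
    unfolding W_def by measurable
  have K_le: "(\<integral>\<^sup>+u. K u v \<partial>?\<mu>) \<le> ennreal \<kappa>" for v
  proof -
    have "(\<integral>\<^sup>+u. K u v \<partial>?\<mu>) = (\<integral>\<^sup>+y. ennreal (exp (1 - t * torus_dist n y (fst v))) \<partial>torus_uniform n) *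
        (\<integral>\<^sup>+r. indicator {h<..} r \<partial>M)"
      unfolding K_def by (rule nn_integral_mark) measurable
    also have "(\<integral>\<^sup>+r. indicator {h<..} r \<partial>M) = ennreal (measure M {h<..})"
      using M_sets by (simp add: M.emeasure_eq_measure)
    also have "(\<integral>\<^sup>+y. ennreal (exp (1 - t * torus_dist n y (fst v))) \<partial>torus_uniform n) =
        (\<integral>\<^sup>+y. ennreal (exp 1) * ennreal (exp (- t * torus_dist n y (fst v))) \<partial>torus_uniform n)"
      by (simp add: ennreal_mult'[symmetric] flip: exp_add)
    also have "\<dots> = ennreal (exp 1) * (\<integral>\<^sup>+y. ennreal (exp (- t * torus_dist n y (fst v))) \<partial>torus_uniform n)"
      by (rule nn_integral_cmult) measurable
    also have "\<dots> * ennreal (measure M {h<..}) \<le> ennreal (exp 1) * ennreal q * ennreal (measure M {h<..})"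
      by (intro mult_right_mono mult_left_mono q) auto
    also have "\<dots> = ennreal \<kappa>"
      using q by (simp add: \<kappa>_def ennreal_mult'[symmetric] ennreal_mult''[symmetric] mult_ac)
    finally show ?thesis .
  qed
  \<comment> \<open>The tail probability of the last point is given away, which leaves a factor N
    outside the series; exp(-b) will compensate for it.\<close>
  have W_le: "(\<integral>\<^sup>+u. W u \<partial>?\<mu>) \<le> 1"
  proof -
    have "(\<integral>\<^sup>+u. W u \<partial>?\<mu>) \<le> (\<integral>\<^sup>+u. 1 \<partial>?\<mu>)"
      unfolding W_def by (intro nn_integral_mono) (auto simp: indicator_def)
    then show ?thesis using prob_space.emeasure_space_1[OF prob_space_mark[where 'd='d]] by simp
  qed
  have S: "finite (S m)" "card (S m) \<le> N ^ Suc m" for m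
  proof -
    have "S m \<subseteq> {xs. set xs \<subseteq> {..<N} \<and> length xs = Suc m}" by (auto simp: S_def)
    moreover have "finite {xs. set xs \<subseteq> {..<N} \<and> length xs = Suc m}" by (intro finite_lists_length_eq) simp
    ultimately show "finite (S m)" "card (S m) \<le> N ^ Suc m"
      using card_mono card_lists_length_eq[of "{..<N}" "Suc m"] finite_subset by fastforce+
  qed
  have c_meas [measurable]: "c xs \<in> borel_measurable (marked_points n M N)" if "xs \<in> S m" for xs m
    unfolding c_def marked_points_def
    using that K W by (intro borel_measurable_chain_weight) (auto simp: S_def)
  have c_le: "(\<integral>\<^sup>+\<omega>. c xs \<omega> \<partial>marked_points n M N) \<le> ennreal (\<kappa> ^ m)" if "xs \<in> S m" for xs m
  proof -
    have "(\<integral>\<^sup>+\<omega>. c xs \<omega> \<partial>marked_points n M N) \<le> ennreal \<kappa> ^ (length xs - 1) * 1"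
      unfolding c_def marked_points_def using that K_le
      by (intro nn_integral_chain_weight_le[OF prob_space_mark K W _ W_le]) (auto simp: S_def)
    also have "\<dots> = ennreal (\<kappa> ^ m)" using that \<kappa> by (simp add: S_def ennreal_power)
    finally show ?thesis .
  qed
  show thesis
  proof (rule that)
    show "F \<in> borel_measurable (marked_points n M N)"
      unfolding F_def by (intro borel_measurable_sum borel_measurable_times_ennreal) (auto intro: c_meas)
    have "(\<integral>\<^sup>+\<omega>. F \<omega> \<partial>marked_points n M N) =
        (\<Sum>m<N. \<Sum>xs\<in>S m. ennreal (exp (- b)) * (\<integral>\<^sup>+\<omega>. c xs \<omega> \<partial>marked_points n M N))"
    proof -
      have "(\<integral>\<^sup>+\<omega>. F \<omega> \<partial>marked_points n M N) =
        (\<Sum>m<N. \<integral>\<^sup>+\<omega>. (\<Sum>xs\<in>S m. ennreal (exp (- b)) * c xs \<omega>) \<partial>marked_points n M N)"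
        unfolding F_def by (intro nn_integral_sum borel_measurable_sum borel_measurable_times_ennreal) (auto intro: c_meas)
      also have "\<dots> = (\<Sum>m<N. \<Sum>xs\<in>S m. \<integral>\<^sup>+\<omega>. ennreal (exp (- b)) * c xs \<omega> \<partial>marked_points n M N)"
        by (intro sum.cong nn_integral_sum borel_measurable_times_ennreal) (auto intro: c_meas)
      also have "\<dots> = (\<Sum>m<N. \<Sum>xs\<in>S m. ennreal (exp (- b)) * (\<integral>\<^sup>+\<omega>. c xs \<omega> \<partial>marked_points n M N))"
        by (intro sum.cong nn_integral_cmult) (auto intro: c_meas)
      finally show ?thesis .
    qed
    also have "\<dots> \<le> (\<Sum>m<N. \<Sum>xs\<in>S m. ennreal (exp (- b)) * ennreal (\<kappa> ^ m))"
      by (intro sum_mono mult_left_mono c_le) auto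
    also have "\<dots> = ennreal (\<Sum>m<N. card (S m) * (exp (- b) * \<kappa> ^ m))"
      using \<kappa> by (subst sum_ennreal[symmetric]) (auto simp: ennreal_mult' ennreal_of_nat_eq_real_of_nat)
    also have "\<dots> \<le> ennreal (2 * real N * exp (- b))"
    proof (rule ennreal_leI)
      have "(\<Sum>m<N. card (S m) * (exp (- b) * \<kappa> ^ m)) \<le> (\<Sum>m<N. real N * exp (- b) * (1 / 2) ^ m)"
      proof (rule sum_mono)
        fix m
        have "card (S m) * (exp (- b) * \<kappa> ^ m) \<le> real (N ^ Suc m) * (exp (- b) * \<kappa> ^ m)"
          using S(2)[of m] \<kappa> by (intro mult_right_mono) (auto simp del: power_Suc of_nat_power)
        also have "\<dots> = real N * exp (- b) * (\<kappa> * N) ^ m" by (simp add: power_mult_distrib)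
        also have "\<dots> \<le> real N * exp (- b) * (1 / 2) ^ m"
          using small \<kappa> by (intro mult_left_mono power_mono) (auto simp: \<kappa>_def)
        finally show "card (S m) * (exp (- b) * \<kappa> ^ m) \<le> real N * exp (- b) * (1 / 2) ^ m" .
      qed
      also have "\<dots> = real N * exp (- b) * (\<Sum>m<N. (1 / 2) ^ m)" by (simp add: sum_distrib_left)
      also have "\<dots> \<le> real N * exp (- b) * 2"
        by (intro mult_left_mono) (auto simp: sum_gp_strict)
      finally show "(\<Sum>m<N. card (S m) * (exp (- b) * \<kappa> ^ m)) \<le> 2 * real N * exp (- b)"
        by (simp add: mult_ac)
    qed
    finally show "(\<integral>\<^sup>+\<omega>. F \<omega> \<partial>marked_points n M N) \<le> ennreal (2 * real N * exp (- b))" .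
  next
    fix \<omega> and xs :: "nat list"
    assume F: "F \<omega> < 1" and xs: "xs \<noteq> []" "distinct xs" "set xs \<subseteq> {..<N}"
      and large: "\<And>i. i \<in> set xs \<Longrightarrow> h < snd (\<omega> i)"
    let ?D = "\<lambda>i j. torus_dist n (fst (\<omega> i)) (fst (\<omega> j))"
    define m where "m = length xs - 1"
    have "length xs \<le> N" using xs by (metis card_lessThan card_mono distinct_card finite_lessThan)
    then have m: "m < N" "xs \<in> S m" using xs by (cases xs; auto simp: m_def S_def)+
    \<comment> \<open>The term of \<open>xs\<close> itself is at most F < 1, so its exponent is
      negative, which is the claimed bound.\<close>
    have "chain_weight (\<lambda>i j. ennreal (exp (1 - t * ?D i j)) * indicator {i. h < snd (\<omega> i)} i)
      (indicator {i. h < snd (\<omega> i)}) xs = ennreal (exp (real (length xs) - 1 - t * chain_length ?D xs))"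
      using xs large by (intro chain_weight_exp) auto
    also have "chain_weight (\<lambda>i j. ennreal (exp (1 - t * ?D i j)) * indicator {i. h < snd (\<omega> i)} i)
      (indicator {i. h < snd (\<omega> i)}) xs = c xs \<omega>"
      unfolding c_def K_def W_def by (intro chain_weight_cong) (auto simp: indicator_def)
    finally have "ennreal (exp (- b)) * ennreal (exp (real (length xs) - 1 - t * chain_length ?D xs)) =
        ennreal (exp (- b)) * c xs \<omega>" by simp
    also have "\<dots> \<le> (\<Sum>xs\<in>S m. ennreal (exp (- b)) * c xs \<omega>)"
      using S(1) m by (intro member_le_sum) auto
    also have "\<dots> \<le> F \<omega>" unfolding F_def using m by (intro member_le_sum) auto
    also note F
    finally have "exp (- b + (real (length xs) - 1 - t * chain_length ?D xs)) < 1"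
      by (simp add: ennreal_mult'[symmetric] mult_exp_exp)
    then show "real (length xs) \<le> 1 + b + t * chain_length ?D xs" by simp
  qed
qed

text \<open>Here F counts the marks above h, and F < 1 means that there are none.\<close>

lemma all_marks_le:
  fixes N :: nat
  obtains F where "F \<in> borel_measurable (marked_points n M N :: (nat \<Rightarrow> (real^'d) \<times> real) measure)"
    "(\<integral>\<^sup>+\<omega>. F \<omega> \<partial>marked_points n M N) \<le> ennreal (real N * measure M {h<..})"
    "\<And>\<omega> i. F \<omega> < 1 \<Longrightarrow> i < N \<Longrightarrow> snd (\<omega> i) \<le> h"
proof
  interpret M: prob_space M by (rule M_prob)
  let ?F = "\<lambda>\<omega> :: nat \<Rightarrow> (real^'d) \<times> real. \<Sum>i<N. indicator {h<..} (snd (\<omega> i)) :: ennreal"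
  have meas: "(\<lambda>\<omega>. indicator {h<..} (snd (\<omega> i)) :: ennreal) \<in>
    borel_measurable (marked_points n M N :: (nat \<Rightarrow> (real^'d) \<times> real) measure)" if "i < N" for i
    using measurable_marked_points_components(2)[OF that M_sets] by measurable
  then show "?F \<in> borel_measurable (marked_points n M N)" by (intro borel_measurable_sum) auto
  have "(\<integral>\<^sup>+\<omega>. ?F \<omega> \<partial>marked_points n M N) =
      (\<Sum>i<N. \<integral>\<^sup>+\<omega>. indicator {h<..} (snd (\<omega> i)) \<partial>(marked_points n M N :: (nat \<Rightarrow> (real^'d) \<times> real) measure))"
    using meas by (intro nn_integral_sum) auto
  also have "\<dots> \<le> (\<Sum>i<N. ennreal (measure M {h<..}))"
  proof (intro sum_mono)
    fix i assume i: "i \<in> {..<N}"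
    have "(\<integral>\<^sup>+u. indicator {h<..} (snd u) \<partial>(torus_uniform n \<Otimes>\<^sub>M M :: ((real^'d) \<times> real) measure)) =
        (\<integral>\<^sup>+u. 1 * indicator {h<..} (snd u) \<partial>(torus_uniform n \<Otimes>\<^sub>M M :: ((real^'d) \<times> real) measure))"
      by simp
    also have "\<dots> = (\<integral>\<^sup>+y. 1 \<partial>(torus_uniform n :: (real^'d) measure)) * (\<integral>\<^sup>+r. indicator {h<..} r \<partial>M)"
      by (rule nn_integral_mark) measurable
    also have "\<dots> = ennreal (measure M {h<..})"
      using M_sets prob_space.emeasure_space_1[OF prob_space_torus_uniform[OF n, where 'd='d]]
      by (simp add: M.emeasure_eq_measure)
    finally have *: "(\<integral>\<^sup>+u. indicator {h<..} (snd u) \<partial>(torus_uniform n \<Otimes>\<^sub>M M :: ((real^'d) \<times> real) measure)) \<le>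
      ennreal (measure M {h<..})" by simp
    have "(\<lambda>u. indicator {h<..} (snd u) :: ennreal) \<in> borel_measurable (torus_uniform n \<Otimes>\<^sub>M M :: ((real^'d) \<times> real) measure)"
      by measurable
    \<comment> \<open>The weight of a one-element chain is \<open>W\<close> alone, so the chain
      bound with zero kernel gives the estimate for a single coordinate.\<close>
    from nn_integral_chain_weight_le[OF prob_space_mark _ this _ *, of "\<lambda>_ _. 0" 0 "{..<N}" "[i]"] i
    show "(\<integral>\<^sup>+\<omega>. indicator {h<..} (snd (\<omega> i)) \<partial>(marked_points n M N :: (nat \<Rightarrow> (real^'d) \<times> real) measure))
      \<le> ennreal (measure M {h<..})" by (simp add: marked_points_def)
  qed
  also have "\<dots> = ennreal (real N * measure M {h<..})" by (simp add: ennreal_mult' ennreal_of_nat_eq_real_of_nat)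
  finally show "(\<integral>\<^sup>+\<omega>. ?F \<omega> \<partial>marked_points n M N) \<le> ennreal (real N * measure M {h<..})" .
  fix \<omega> :: "nat \<Rightarrow> (real^'d) \<times> real" and i assume "?F \<omega> < 1" "i < N"
  moreover have "indicator {h<..} (snd (\<omega> i)) \<le> ?F \<omega>" using \<open>i < N\<close> by (intro member_le_sum) auto
  ultimately show "snd (\<omega> i) \<le> h" by (auto simp: indicator_def split: if_splits)
qed

text \<open>F is the indicator that all N points miss the ball of radius n/16 around x, and
  independence makes its integral a power. As n/4 + n/16 < n/2, the Euclidean ball lies inside the
  cube, so the probability of hitting it is at least a constant free of n. That the base is
  nonnegative comes along, since this constant is bounded by a probability.\<close>

lemma point_nearby:
  fixes x :: "real^'d" and N :: nat
  assumes x: "\<And>i. \<bar>x $ i\<bar> \<le> n / 4"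
  obtains F where "F \<in> borel_measurable (marked_points n M N :: (nat \<Rightarrow> (real^'d) \<times> real) measure)"
    "(\<integral>\<^sup>+\<omega>. F \<omega> \<partial>marked_points n M N) \<le> ennreal ((1 - unit_ball_vol CARD('d) / 16 ^ CARD('d)) ^ N)"
    "0 \<le> 1 - unit_ball_vol CARD('d) / 16 ^ CARD('d)"
    "\<And>\<omega>. F \<omega> < 1 \<Longrightarrow> \<exists>i<N. torus_dist n x (fst (\<omega> i)) \<le> n / 16"
proof
  let ?\<mu> = "torus_uniform n \<Otimes>\<^sub>M M :: ((real^'d) \<times> real) measure"
  let ?c = "unit_ball_vol CARD('d) / 16 ^ CARD('d)"
  interpret M: prob_space M by (rule M_prob)
  interpret U: prob_space "torus_uniform n :: (real^'d) measure" by (rule prob_space_torus_uniform[OF n])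
  interpret \<mu>: prob_space ?\<mu> by (rule prob_space_mark)
  interpret P: product_prob_space "\<lambda>_. ?\<mu>" ..
  define B where "B = {y. torus_dist n x y \<le> n / 16}"
  have [measurable]: "B \<in> sets borel" unfolding B_def by measurable
  let ?F = "\<lambda>\<omega> :: nat \<Rightarrow> (real^'d) \<times> real. \<Prod>i<N. indicator (- B) (fst (\<omega> i)) :: ennreal"
  have "cball x (n / 16) \<subseteq> torus_cube n \<inter> B"
  proof
    fix y assume "y \<in> cball x (n / 16)"
    then have y: "norm (x - y) \<le> n / 16" by (simp add: dist_norm)
    have "\<bar>y $ i\<bar> \<le> n / 2" for i
      using x[of i] component_le_norm_cart[of "x - y" i] y n by simp
    then have "y \<in> torus_cube n" unfolding mem_torus_cube by blast
    then show "y \<in> torus_cube n \<inter> B"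
      using torus_dist_le_norm[of n x y] y by (auto simp: B_def)
  qed
  then have "emeasure lborel (cball x (n / 16)) \<le> emeasure lborel (torus_cube n \<inter> B)"
    by (intro emeasure_mono) auto
  then have "ennreal (unit_ball_vol CARD('d) * (n / 16) ^ CARD('d)) / ennreal (n ^ CARD('d)) \<le> emeasure (torus_uniform n) B"
    using n by (subst emeasure_torus_uniform) (auto simp: emeasure_cball intro!: divide_right_mono_ennreal)
  also have "ennreal (unit_ball_vol CARD('d) * (n / 16) ^ CARD('d)) / ennreal (n ^ CARD('d)) = ennreal ?c"
    using n by (simp add: divide_ennreal power_divide)
  finally have "ennreal ?c \<le> ennreal (U.prob B)" by (simp only: U.emeasure_eq_measure)
  then have c: "?c \<le> U.prob B" by (rule ennreal_le_iff[OF measure_nonneg, THEN iffD1])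
  then show c1: "0 \<le> 1 - ?c" using U.prob_le_1[of B] by linarith
  have "(\<integral>\<^sup>+u. indicator (- B) (fst u) \<partial>?\<mu>) = (\<integral>\<^sup>+u. indicator (- B) (fst u) * 1 \<partial>?\<mu>)" by simp
  also have "\<dots> = (\<integral>\<^sup>+y. indicator (- B) y \<partial>torus_uniform n) * (\<integral>\<^sup>+r. 1 \<partial>M)"
    by (rule nn_integral_mark) measurable
  also have "(\<integral>\<^sup>+y. indicator (- B) y \<partial>torus_uniform n) = ennreal (U.prob (- B))"
    by (subst nn_integral_indicator, measurable) (rule U.emeasure_eq_measure)
  also have "(\<integral>\<^sup>+r. 1 \<partial>M) = 1" by (simp add: M.emeasure_space_1)
  also have "ennreal (U.prob (- B)) * 1 = ennreal (1 - U.prob B)" using U.prob_compl[of B] by (simp add: Compl_eq_Diff_UNIV)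
  also have "\<dots> \<le> ennreal (1 - ?c)" using c by (intro ennreal_leI) simp
  finally have int: "(\<integral>\<^sup>+u. indicator (- B) (fst u) \<partial>?\<mu>) \<le> ennreal (1 - ?c)" .
  show "?F \<in> borel_measurable (marked_points n M N)"
  proof (intro borel_measurable_prod_ennreal)
    fix i assume "i \<in> {..<N}"
    then have "i < N" by simp
    from measurable_marked_points_components(1)[OF this M_sets]
    show "(\<lambda>\<omega>. indicator (- B) (fst (\<omega> i)) :: ennreal) \<in> borel_measurable (marked_points n M N)" by measurable
  qed
  have "(\<integral>\<^sup>+\<omega>. ?F \<omega> \<partial>marked_points n M N) = (\<Prod>i<N. \<integral>\<^sup>+u. indicator (- B) (fst u) \<partial>?\<mu>)"
    unfolding marked_points_def by (rule P.product_nn_integral_prod) auto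
  also have "\<dots> \<le> (\<Prod>i<N. ennreal (1 - ?c))" using int by (simp only: prod_constant power_mono_ennreal)
  also have "\<dots> = ennreal ((1 - ?c) ^ N)" using c1 by (simp add: ennreal_power)
  finally show "(\<integral>\<^sup>+\<omega>. ?F \<omega> \<partial>marked_points n M N) \<le> ennreal ((1 - ?c) ^ N)" .
  fix \<omega> :: "nat \<Rightarrow> (real^'d) \<times> real" assume F: "?F \<omega> < 1"
  show "\<exists>i<N. torus_dist n x (fst (\<omega> i)) \<le> n / 16"
  proof (rule ccontr)
    assume "\<not> (\<exists>i<N. torus_dist n x (fst (\<omega> i)) \<le> n / 16)"
    then have "?F \<omega> = 1" by (intro prod.neutral) (auto simp: B_def indicator_def)
    with F show False by simp
  qed
qed

end

subsection \<open>The chemical distance\<close>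

lemma successively_gilbert_adj_subset:
  assumes "successively (\<lambda>u v. (u, v) \<in> gilbert_adj n N \<omega>) vs" "vs \<noteq> []" "hd vs < N"
  shows "set vs \<subseteq> {..<N}"
  using assms
proof (induction vs)
  case (Cons x xs)
  then show ?case by (cases xs) (auto simp: gilbert_adj_def)
qed simp

text \<open>All randomness is in the hypotheses: a path with too few edges would have a length bound
  below the distance of its end points.\<close>

lemma chem_dist_ge_of_sparse:
  fixes \<omega> :: "nat \<Rightarrow> (real^'d) \<times> real" and i0 :: 'd and L b n :: real
  assumes n: "0 < n"
    and near: "\<exists>i<N. torus_dist n (- (n / 4) *\<^sub>R axis i0 1) (fst (\<omega> i)) \<le> n / 16"
      "\<exists>i<N. torus_dist n ((n / 4) *\<^sub>R axis i0 1) (fst (\<omega> i)) \<le> n / 16"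
    and marks: "\<And>i. i < N \<Longrightarrow> snd (\<omega> i) \<le> 2 ^ Suc J"
    and j0: "j0 \<le> Suc J" and b: "0 \<le> b"
    and t: "(\<Sum>j=j0..J. 2 ^ j * t j) \<le> 1 / 4" "\<And>j. 0 \<le> t j"
    and sparse: "\<And>j xs. j0 \<le> j \<Longrightarrow> j \<le> J \<Longrightarrow> xs \<noteq> [] \<Longrightarrow> distinct xs \<Longrightarrow> set xs \<subseteq> {..<N} \<Longrightarrow>
      (\<And>i. i \<in> set xs \<Longrightarrow> 2 ^ j < snd (\<omega> i)) \<Longrightarrow>
      real (length xs) \<le> 1 + b + t j * chain_length (\<lambda>i j. torus_dist n (fst (\<omega> i)) (fst (\<omega> j))) xs"
    and L: "4 * 2 ^ j0 * (L + 1) + 8 * 2 ^ J * (1 + b) < n / 4"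
    and closest: "is_closest n N \<omega> (- (n / 4) *\<^sub>R axis i0 1) i" "is_closest n N \<omega> ((n / 4) *\<^sub>R axis i0 1) j"
  shows "chem_dist_ge n N \<omega> i j L"
  unfolding chem_dist_ge_def
proof (intro allI impI notI)
  fix k :: nat assume k: "real k < L" and path: "(i, j) \<in> gilbert_adj n N \<omega> ^^ k"
  define D where "D i j = torus_dist n (fst (\<omega> i)) (fst (\<omega> j))" for i j
  interpret semimetric D
  proof
    fix i j l
    show "0 \<le> D i j" by (simp add: D_def torus_dist_nonneg)
    show "D i i = 0"
      unfolding D_def using torus_dist_nonneg[of n "fst (\<omega> i)" "fst (\<omega> i)"] torus_dist_le_norm[of n "fst (\<omega> i)" "fst (\<omega> i)"] by simp
    show "D i l \<le> D i j + D j l" unfolding D_def by (rule torus_dist_triangle)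
  qed
  obtain vs where vs: "vs \<noteq> []" "distinct vs" "hd vs = i" "last vs = j"
    "successively (\<lambda>u v. (u, v) \<in> gilbert_adj n N \<omega>) vs" "length vs \<le> Suc k"
    using path by (rule relpow_imp_distinct_path)
  have sub: "set vs \<subseteq> {..<N}"
    using vs closest by (intro successively_gilbert_adj_subset[of n]) (auto simp: is_closest_def)
  have "torus_dist n (- (n / 4) *\<^sub>R axis i0 1) (fst (\<omega> i)) \<le> n / 16"
    "torus_dist n ((n / 4) *\<^sub>R axis i0 1) (fst (\<omega> j)) \<le> n / 16"
    using closest near unfolding is_closest_def by (meson order_trans)+
  moreover have "n / 2 \<le> torus_dist n (- (n / 4) *\<^sub>R axis i0 1) ((n / 4) *\<^sub>R (axis i0 1 :: real^'d))"
    using n by (intro torus_dist_axis) simp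
  \<comment> \<open>The two closest points are at distance at least n/2 - 2 n/16 = 3n/8.\<close>
  ultimately have "n / 4 \<le> D i j"
    using torus_dist_triangle[of n "- (n / 4) *\<^sub>R axis i0 1" "(n / 4) *\<^sub>R axis i0 1" "fst (\<omega> i)"]
      torus_dist_triangle[of n "fst (\<omega> i)" "(n / 4) *\<^sub>R axis i0 1" "fst (\<omega> j)"] n
      torus_dist_commute[of n "(n / 4) *\<^sub>R axis i0 1" "fst (\<omega> j)"]
    unfolding D_def by linarith
  also have "D i j \<le> chain_length D vs" using dist_hd_last_le[OF vs(1)] vs by simp
  also have "chain_length D vs \<le> 4 * 2 ^ j0 * length vs + 8 * 2 ^ J * (1 + b)"
  proof (rule chain_length_le_of_scales[where r = "\<lambda>i. snd (\<omega> i)" and t = t])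
    show "successively (\<lambda>x y. D x y \<le> snd (\<omega> x) \<or> D x y \<le> snd (\<omega> y)) vs"
      using vs(5) by (rule successively_mono)
        (auto simp: gilbert_adj_def D_def torus_dist_commute)
    show "snd (\<omega> x) \<le> 2 ^ Suc J" if "x \<in> set vs" for x
      using marks that sub by blast
    \<comment> \<open>The filtered vertices are distinct but need not form a path, which is why
      sparseness is assumed for all sequences.\<close>
    show "real (length (filter (\<lambda>x. 2 ^ j < snd (\<omega> x)) vs)) \<le> 1 + b +
        t j * chain_length D (filter (\<lambda>x. 2 ^ j < snd (\<omega> x)) vs)"
      if "j0 \<le> j" "j \<le> J" "filter (\<lambda>x. 2 ^ j < snd (\<omega> x)) vs \<noteq> []" for j
      unfolding D_def using that vs sub by (intro sparse) auto
  qed (use j0 b t in auto)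
  \<comment> \<open>Fewer than L edges means fewer than L + 1 vertices.\<close>
  also have "\<dots> \<le> 4 * 2 ^ j0 * (L + 1) + 8 * 2 ^ J * (1 + b)"
    using vs(6) k by (intro add_right_mono mult_left_mono) auto
  finally show False using L by simp
qed

section \<open>Measurability of the chemical distance event\<close>

lemma pred_is_closest:
  fixes z :: "real^'d"
  assumes M: "sets M = sets borel"
  shows "Measurable.pred (marked_points n M N) (\<lambda>\<omega>. is_closest n' N \<omega> z i)"
proof (cases "i < N")
  case True
  note components = measurable_marked_points_components(1)[OF _ M, where 'd='d]
  have "Measurable.pred (marked_points n M N)
      (\<lambda>\<omega>. j < N \<longrightarrow> torus_dist n' z (fst (\<omega> i)) \<le> torus_dist n' z (fst (\<omega> j)))" for j
  proof (cases "j < N")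
    case j: True
    have "Measurable.pred (marked_points n M N) (\<lambda>\<omega>. torus_dist n' z (fst (\<omega> i)) \<le> torus_dist n' z (fst (\<omega> j)))"
      unfolding pred_def
      by (intro borel_measurable_le borel_measurable_torus_dist borel_measurable_const components True j)
    then show ?thesis using j by simp
  qed simp
  then have "Measurable.pred (marked_points n M N)
      (\<lambda>\<omega>. \<forall>j. j < N \<longrightarrow> torus_dist n' z (fst (\<omega> i)) \<le> torus_dist n' z (fst (\<omega> j)))"
    by (rule pred_intros_countable)
  with True show ?thesis unfolding is_closest_def by (simp only: simp_thms)
next
  case False
  then have "(\<lambda>\<omega> :: nat \<Rightarrow> (real^'d) \<times> real. is_closest n' N \<omega> z i) = (\<lambda>_. False)"
    by (simp only: is_closest_def simp_thms)
  then show ?thesis by simp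
qed

lemma pred_gilbert_adj:
  assumes M: "sets M = sets borel"
  shows "Measurable.pred (marked_points n M N :: (nat \<Rightarrow> (real^'d) \<times> real) measure)
      (\<lambda>\<omega>. (i, j) \<in> gilbert_adj n' N \<omega>)"
proof (cases "i < N \<and> j < N")
  case True
  then have ij: "i < N" "j < N" by auto
  note components = measurable_marked_points_components[OF _ M, where 'd='d]
  have *: "Measurable.pred (marked_points n M N :: (nat \<Rightarrow> (real^'d) \<times> real) measure)
      (\<lambda>\<omega>. torus_dist n' (fst (\<omega> i)) (fst (\<omega> j)) \<le> snd (\<omega> i))" if "i < N" "j < N" for i j
    unfolding pred_def
    by (intro borel_measurable_le borel_measurable_torus_dist components that)
  have "Measurable.pred (marked_points n M N :: (nat \<Rightarrow> (real^'d) \<times> real) measure) (\<lambda>\<omega>.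
      torus_dist n' (fst (\<omega> i)) (fst (\<omega> j)) \<le> snd (\<omega> i) \<or>
      torus_dist n' (fst (\<omega> j)) (fst (\<omega> i)) \<le> snd (\<omega> j))"
    by (intro pred_intros_logic * ij)
  with ij show ?thesis by (simp only: gilbert_adj_def mem_Collect_eq prod.case simp_thms)
next
  case False
  then have "(\<lambda>\<omega> :: nat \<Rightarrow> (real^'d) \<times> real. (i, j) \<in> gilbert_adj n' N \<omega>) = (\<lambda>_. False)"
    by (auto simp: gilbert_adj_def)
  then show ?thesis by simp
qed

lemma pred_relpow_gilbert_adj:
  assumes M: "sets M = sets borel"
  shows "Measurable.pred (marked_points n M N :: (nat \<Rightarrow> (real^'d) \<times> real) measure)
      (\<lambda>\<omega>. (i, j) \<in> gilbert_adj n' N \<omega> ^^ k)"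
proof (induction k arbitrary: j)
  case (Suc k)
  have "(\<lambda>\<omega> :: nat \<Rightarrow> (real^'d) \<times> real. (i, j) \<in> gilbert_adj n' N \<omega> ^^ Suc k) =
      (\<lambda>\<omega>. \<exists>m. (i, m) \<in> gilbert_adj n' N \<omega> ^^ k \<and> (m, j) \<in> gilbert_adj n' N \<omega>)"
    by (auto simp: relcomp_unfold)
  also have "Measurable.pred (marked_points n M N) \<dots>"
    by (intro pred_intros_countable pred_intros_logic Suc pred_gilbert_adj M)
  finally show ?case .
qed simp

text \<open>Vertices are natural numbers, so all quantifiers, including those over intermediate
  vertices of a path, are countable. Measurability is what permits passing to the complementary
  event.\<close>

lemma pred_chem_dist_ge:
  fixes M :: "real measure" and x y :: "real^'d"
  assumes M: "sets M = sets borel"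
  shows "Measurable.pred (marked_points n M N) (\<lambda>\<omega>. \<forall>i j. is_closest n' N \<omega> x i \<and> is_closest n' N \<omega> y j \<longrightarrow>
    chem_dist_ge n' N \<omega> i j L)"
  unfolding chem_dist_ge_def
  by (intro pred_intros_countable pred_intros_logic pred_is_closest pred_relpow_gilbert_adj M measurable_const) simp_all

text \<open>The terms bound the three kinds of failure: a mark above the largest scale, a violation
  of sparseness at one of at most J + 1 scales, and the absence of points near one of the two
  reference locations.\<close>

lemma chem_dist_fail_prob_le:
  fixes M :: "real measure" and i0 :: "'d::finite" and n b L :: real and N J j0 :: nat and t q :: "nat \<Rightarrow> real"
  defines "E \<equiv> \<lambda>\<omega>. \<forall>i j. is_closest n N \<omega> (- (n / 4) *\<^sub>R (axis i0 1 :: real^'d)) i \<and>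
      is_closest n N \<omega> ((n / 4) *\<^sub>R (axis i0 1 :: real^'d)) j \<longrightarrow> chem_dist_ge n N \<omega> i j L"
  assumes M: "prob_space M" "sets M = sets borel" and n: "0 < n"
    and q: "\<And>j x. j0 \<le> j \<Longrightarrow> j \<le> J \<Longrightarrow>
        (\<integral>\<^sup>+y. ennreal (exp (- t j * torus_dist n y (x :: real^'d))) \<partial>torus_uniform n) \<le> ennreal (q j)"
      "\<And>j. 0 \<le> q j"
    and small: "\<And>j. j0 \<le> j \<Longrightarrow> j \<le> J \<Longrightarrow> exp 1 * measure M {2 ^ j<..} * q j * N \<le> 1 / 2"
    and j0: "j0 \<le> Suc J" and b: "0 \<le> b"
    and t: "(\<Sum>j=j0..J. 2 ^ j * t j) \<le> 1 / 4" "\<And>j. 0 \<le> t j"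
    and L: "4 * 2 ^ j0 * (L + 1) + 8 * 2 ^ J * (1 + b) < n / 4"
  shows "measure (marked_points n M N) {\<omega> \<in> space (marked_points n M N). \<not> E \<omega>} \<le>
      real N * measure M {2 ^ Suc J<..} + real (Suc J) * (2 * real N * exp (- b)) +
      2 * (1 - unit_ball_vol CARD('d) / 16 ^ CARD('d)) ^ N" (is "_ \<le> ?B")
proof -
  let ?P = "marked_points n M N :: (nat \<Rightarrow> (real^'d) \<times> real) measure"
  let ?c = "1 - unit_ball_vol CARD('d) / 16 ^ CARD('d)"
  let ?x = "- (n / 4) *\<^sub>R axis i0 1 :: real^'d" and ?y = "(n / 4) *\<^sub>R axis i0 1 :: real^'d"
  interpret P: prob_space ?P using M n by (rule prob_space_marked_points)
  have x: "\<bar>?x $ i\<bar> \<le> n / 4" "\<bar>?y $ i\<bar> \<le> n / 4" for i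
    using n by (auto simp: axis_def)
  obtain F1 where F1: "F1 \<in> borel_measurable ?P" "(\<integral>\<^sup>+\<omega>. F1 \<omega> \<partial>?P) \<le> ennreal (real N * measure M {2 ^ Suc J<..})"
    "\<And>\<omega> i. F1 \<omega> < 1 \<Longrightarrow> i < N \<Longrightarrow> snd (\<omega> i) \<le> 2 ^ Suc J"
    by (rule all_marks_le[OF M n, where 'd='d and N = N and h = "2 ^ Suc J"]) (rule that)
  obtain F2 where F2: "F2 \<in> borel_measurable ?P" "(\<integral>\<^sup>+\<omega>. F2 \<omega> \<partial>?P) \<le> ennreal (?c ^ N)" "0 \<le> ?c"
    "\<And>\<omega>. F2 \<omega> < 1 \<Longrightarrow> \<exists>i<N. torus_dist n ?x (fst (\<omega> i)) \<le> n / 16"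
    by (rule point_nearby[OF M n x(1), where N = N]) (rule that)
  obtain F3 where F3: "F3 \<in> borel_measurable ?P" "(\<integral>\<^sup>+\<omega>. F3 \<omega> \<partial>?P) \<le> ennreal (?c ^ N)" "0 \<le> ?c"
    "\<And>\<omega>. F3 \<omega> < 1 \<Longrightarrow> \<exists>i<N. torus_dist n ?y (fst (\<omega> i)) \<le> n / 16"
    by (rule point_nearby[OF M n x(2), where N = N]) (rule that)
  define Q where "Q j F \<longleftrightarrow> F \<in> borel_measurable ?P \<and>
    (\<integral>\<^sup>+\<omega>. F \<omega> \<partial>?P) \<le> ennreal (2 * real N * exp (- b)) \<and>
    (\<forall>\<omega> xs. F \<omega> < 1 \<longrightarrow> xs \<noteq> [] \<longrightarrow> distinct xs \<longrightarrow> set xs \<subseteq> {..<N} \<longrightarrow>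
      (\<forall>i\<in>set xs. 2 ^ j < snd (\<omega> i)) \<longrightarrow>
      real (length xs) \<le> 1 + b + t j * chain_length (\<lambda>i j. torus_dist n (fst (\<omega> i)) (fst (\<omega> j))) xs)"
    for j F
  have "\<forall>j\<in>{j0..J}. \<exists>F. Q j F"
  proof
    fix j assume "j \<in> {j0..J}"
    then have j: "j0 \<le> j" "j \<le> J" by auto
    show "\<exists>F. Q j F"
      by (rule sparse_large_marks[OF M n q(1)[OF j] q(2) small[OF j], of b])
        (unfold Q_def, intro exI conjI allI impI, assumption+, blast)
  qed
  then obtain F where F: "\<And>j. j \<in> {j0..J} \<Longrightarrow> Q j (F j)"
    using bchoice by (metis (lifting))
  \<comment> \<open>Each summand is at most G, so G < 1 excludes all failures at once, and the
    indicator of failure is bounded by G.\<close>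
  define G where "G \<omega> = F1 \<omega> + (\<Sum>j=j0..J. F j \<omega>) + (F2 \<omega> + F3 \<omega>)" for \<omega>
  have E_of_G: "E \<omega>" if "G \<omega> < 1" for \<omega>
  proof -
    have "F1 \<omega> \<le> G \<omega>" "F2 \<omega> \<le> G \<omega>" "F3 \<omega> \<le> G \<omega>" "(\<Sum>j=j0..J. F j \<omega>) \<le> G \<omega>"
      unfolding G_def by (auto intro: add_increasing add_increasing2)
    moreover have "F j \<omega> \<le> (\<Sum>j=j0..J. F j \<omega>)" if "j \<in> {j0..J}" for j
      using that by (intro member_le_sum) auto
    ultimately have less: "F1 \<omega> < 1" "F2 \<omega> < 1" "F3 \<omega> < 1" "\<And>j. j \<in> {j0..J} \<Longrightarrow> F j \<omega> < 1"
      using that by (meson le_less_trans)+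
    show ?thesis
      unfolding E_def
    proof (intro allI impI)
      fix i j assume closest: "is_closest n N \<omega> ?x i \<and> is_closest n N \<omega> ?y j"
      show "chem_dist_ge n N \<omega> i j L"
      proof (rule chem_dist_ge_of_sparse[OF n F2(4)[OF less(2)] F3(4)[OF less(3)] F1(3)[OF less(1)] j0 b t _ L])
        fix j xs assume "j0 \<le> j" "j \<le> J" and xs: "xs \<noteq> []" "distinct xs" "set xs \<subseteq> {..<N}"
          "\<And>i. i \<in> set xs \<Longrightarrow> 2 ^ j < snd (\<omega> i)"
        then have j: "j \<in> {j0..J}" by simp
        from F[OF j] less(4)[OF j] xs
        show "real (length xs) \<le> 1 + b + t j * chain_length (\<lambda>i j. torus_dist n (fst (\<omega> i)) (fst (\<omega> j))) xs"
          unfolding Q_def by blast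
      qed (use closest in auto)
    qed
  qed
  have pred: "Measurable.pred ?P E" unfolding E_def using M(2) by (rule pred_chem_dist_ge)
  have "ennreal (P.prob {\<omega> \<in> space ?P. \<not> E \<omega>}) = (\<integral>\<^sup>+\<omega>. indicator {\<omega> \<in> space ?P. \<not> E \<omega>} \<omega> \<partial>?P)"
    using pred by (subst nn_integral_indicator) (auto simp: P.emeasure_eq_measure)
  also have "\<dots> \<le> (\<integral>\<^sup>+\<omega>. G \<omega> \<partial>?P)"
    by (intro nn_integral_mono) (use E_of_G in \<open>force simp: indicator_def not_less\<close>)
  also have "\<dots> = (\<integral>\<^sup>+\<omega>. F1 \<omega> \<partial>?P) + (\<Sum>j=j0..J. \<integral>\<^sup>+\<omega>. F j \<omega> \<partial>?P) +
      ((\<integral>\<^sup>+\<omega>. F2 \<omega> \<partial>?P) + (\<integral>\<^sup>+\<omega>. F3 \<omega> \<partial>?P))"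
  proof -
    have F_meas: "F j \<in> borel_measurable ?P" if "j \<in> {j0..J}" for j
      using F[OF that] by (simp add: Q_def)
    have "(\<lambda>\<omega>. \<Sum>j=j0..J. F j \<omega>) \<in> borel_measurable ?P"
      by (intro borel_measurable_sum F_meas)
    moreover have "(\<integral>\<^sup>+\<omega>. (\<Sum>j=j0..J. F j \<omega>) \<partial>?P) = (\<Sum>j=j0..J. \<integral>\<^sup>+\<omega>. F j \<omega> \<partial>?P)"
      by (intro nn_integral_sum F_meas)
    ultimately show ?thesis
      unfolding G_def using F1(1) F2(1) F3(1) by (simp add: nn_integral_add)
  qed
  also have "\<dots> \<le> ennreal (real N * measure M {2 ^ Suc J<..}) + (\<Sum>j=j0..J. ennreal (2 * real N * exp (- b))) +
      (ennreal (?c ^ N) + ennreal (?c ^ N))"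
    using F[unfolded Q_def] F1(2) F2(2) F3(2) by (intro add_mono sum_mono) blast+
  also have "\<dots> = ennreal (real N * measure M {2 ^ Suc J<..} + real (Suc J - j0) * (2 * real N * exp (- b)) +
      (?c ^ N + ?c ^ N))"
    using F2(3) by (simp add: ennreal_plus[symmetric] ennreal_of_nat_eq_real_of_nat
        ennreal_mult'[symmetric] del: ennreal_plus)
  also have "\<dots> \<le> ennreal ?B"
    by (intro ennreal_leI add_mono mult_right_mono) auto
  finally show ?thesis
    using F2(3) by (subst (asm) ennreal_le_iff) (auto intro!: add_nonneg_nonneg)
qed

section \<open>Averaging over the Poisson number of points\<close>

text \<open>This is the generating function of the Poisson law. The values x = 1, x = c and x = e
  will give the total mass, the mean of c^N and a Chernoff bound.\<close>

lemma poisson_pgf_sums: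
  "(\<lambda>N. a ^ N / fact N * exp (- a) * x ^ N) sums exp (a * (x - 1) :: real)"
proof -
  have "(\<lambda>N. (a * x) ^ N /\<^sub>R fact N * exp (- a)) sums (exp (a * x) * exp (- a))"
    by (intro sums_mult2 exp_converges)
  then show ?thesis
    by (simp add: power_mult_distrib divide_inverse mult_ac right_diff_distrib flip: exp_add)
qed

lemma ppp_prob_bounds:
  fixes n \<epsilon> c :: real and E :: "nat \<Rightarrow> (nat \<Rightarrow> (real^'d) \<times> real) \<Rightarrow> bool"
  defines "a \<equiv> n ^ CARD('d)"
  assumes M: "prob_space M" "sets M = sets borel" and n: "0 < n"
    and pred: "\<And>N. Measurable.pred (marked_points n M N) (E N)"
    and c: "0 \<le> c" and \<epsilon>: "0 \<le> \<epsilon>"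
    and fail: "\<And>N. real N \<le> 3 * a \<Longrightarrow>
      measure (marked_points n M N) {\<omega> \<in> space (marked_points n M N). \<not> E N \<omega>} \<le> \<epsilon> + 2 * c ^ N"
  shows "1 - (\<epsilon> + 2 * exp (a * (c - 1)) + exp (- a)) \<le> ppp_prob n M E" "ppp_prob n M E \<le> 1"
proof -
  let ?P = "\<lambda>N. marked_points n M N :: (nat \<Rightarrow> (real^'d) \<times> real) measure"
  define w where "w N = a ^ N / fact N * exp (- a)" for N
  define p where "p N = measure (?P N) {\<omega> \<in> space (?P N). E N \<omega>}" for N
  have a: "0 \<le> a" using n by (simp add: a_def)
  have w: "0 \<le> w N" for N using a by (simp add: w_def)
  have w_pgf: "(\<lambda>N. w N * x ^ N) sums exp (a * (x - 1))" for x
    unfolding w_def by (rule poisson_pgf_sums)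
  have p: "0 \<le> p N" "p N \<le> 1" "1 - (\<epsilon> + 2 * c ^ N + exp (- 3 * a) * exp 1 ^ N) \<le> p N" for N
  proof -
    interpret P: prob_space "?P N" using M n by (rule prob_space_marked_points)
    show "0 \<le> p N" "p N \<le> 1" by (simp_all add: p_def)
    have "{\<omega> \<in> space (?P N). \<not> E N \<omega>} = space (?P N) - {\<omega> \<in> space (?P N). E N \<omega>}" by auto
    then have compl: "P.prob {\<omega> \<in> space (?P N). \<not> E N \<omega>} = 1 - p N"
      using pred[of N] by (simp add: P.prob_compl p_def)
    show "1 - (\<epsilon> + 2 * c ^ N + exp (- 3 * a) * exp 1 ^ N) \<le> p N"
    proof (cases "real N \<le> 3 * a")
      case True
      have "0 \<le> exp (- 3 * a) * exp 1 ^ N" by simp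
      with fail[OF True] show ?thesis unfolding compl by linarith
    next
      case False
      \<comment> \<open>For N > 3a the lower bound becomes nonpositive. The same inequality thus
        holds for all N, and each of its terms has an explicit Poisson mean.\<close>
      then have "1 \<le> exp (real N - 3 * a)" by simp
      also have "\<dots> = exp (- 3 * a) * exp 1 ^ N" by (simp flip: exp_of_nat_mult exp_add)
      finally show ?thesis using \<open>0 \<le> p N\<close> c \<epsilon> by (smt (verit) zero_le_power)
    qed
  qed
  have w_sums: "w sums 1" using w_pgf[of 1] by simp
  have summable: "summable (\<lambda>N. w N * p N)"
    using w p by (intro summable_comparison_test'[OF sums_summable[OF w_sums]])
      (auto simp: abs_mult mult_left_le)
  have ppp: "ppp_prob n M E = (\<Sum>N. w N * p N)"
    unfolding ppp_prob_def w_def p_def a_def ..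
  show "ppp_prob n M E \<le> 1"
  proof -
    have "(\<Sum>N. w N * p N) \<le> (\<Sum>N. w N)"
      using w p by (intro suminf_le summable sums_summable[OF w_sums]) (auto simp: mult_left_le)
    then show ?thesis unfolding ppp using sums_unique[OF w_sums] by simp
  qed
  have "(\<lambda>N. w N - (\<epsilon> * w N + 2 * (w N * c ^ N) + exp (- 3 * a) * (w N * exp 1 ^ N))) sums
      (1 - (\<epsilon> * 1 + 2 * exp (a * (c - 1)) + exp (- 3 * a) * exp (a * (exp 1 - 1))))"
    by (intro sums_diff sums_add sums_mult w_sums w_pgf)
  moreover have "w N - (\<epsilon> * w N + 2 * (w N * c ^ N) + exp (- 3 * a) * (w N * exp 1 ^ N)) \<le> w N * p N" for N
    using mult_left_mono[OF p(3) w, of N N] by (simp add: algebra_simps)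
  ultimately have "1 - (\<epsilon> * 1 + 2 * exp (a * (c - 1)) + exp (- 3 * a) * exp (a * (exp 1 - 1))) \<le> ppp_prob n M E"
    unfolding ppp using summable by (intro sums_le[OF _ _ summable_sums]) auto
  \<comment> \<open>Since e - 1 \<le> 2, the exponent is at most -3a + 2a = -a.\<close>
  moreover have "exp (- 3 * a) * exp (a * (exp 1 - 1)) \<le> exp (- a)"
  proof -
    have "a * (exp 1 - 1) \<le> a * 2" using a exp_le by (intro mult_left_mono) auto
    then show ?thesis by (simp flip: exp_add)
  qed
  ultimately show "1 - (\<epsilon> + 2 * exp (a * (c - 1)) + exp (- a)) \<le> ppp_prob n M E" by simp
qed

lemma dyadic_bracket:
  fixes x :: real
  assumes "1 \<le> x"
  obtains J :: nat where "2 ^ J \<le> x" "x < 2 ^ Suc J"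
proof
  define J where "J = nat \<lfloor>log 2 x\<rfloor>"
  have "0 \<le> log 2 x" using assms by simp
  then have "real J \<le> log 2 x" "log 2 x < real (Suc J)" unfolding J_def by linarith+
  then have "2 powr real J \<le> x" "x < 2 powr real (Suc J)"
    using assms by (simp_all only: le_log_iff log_less_iff)
  then show "2 ^ J \<le> x" "x < 2 ^ Suc J" by (simp_all only: powr_realpow zero_less_numeral)
qed

lemma tail_bound:
  fixes M :: "real measure"
  assumes "((\<lambda>h. h powr s * measure M {h<..}) \<longlongrightarrow> \<beta>) at_top"
  obtains h0 where "1 \<le> h0" "\<And>h. h0 \<le> h \<Longrightarrow> measure M {h<..} \<le> (\<beta> + 1) * h powr (- s)"
proof -
  have "\<forall>\<^sub>F h in at_top. h powr s * measure M {h<..} < \<beta> + 1"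
    using assms by (rule order_tendstoD) simp
  then obtain h1 where h1: "\<And>h. h1 \<le> h \<Longrightarrow> h powr s * measure M {h<..} < \<beta> + 1"
    by (auto simp: eventually_at_top_linorder)
  show thesis
  proof (rule that[of "max 1 h1"])
    fix h :: real assume "max 1 h1 \<le> h"
    then show "measure M {h<..} \<le> (\<beta> + 1) * h powr (- s)"
      using h1[of h] by (simp add: powr_minus field_simps)
  qed simp
qed

section \<open>Choice of parameters and passage to the limit\<close>

theorem theorem2p4:
  fixes M :: "real measure" and \<beta> s \<alpha> :: real and i0 :: "'d::finite"
  assumes dim: "CARD('d) \<ge> 2"
    and M_prob: "prob_space M" and M_sets: "sets M = sets borel"
    and M_nonneg: "AE x in M. 0 \<le> x"
    and M_ac: "absolutely_continuous lborel M"
    and \<beta>_pos: "0 < \<beta>" and s_pos: "0 < s"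
    and tail: "((\<lambda>h. h powr s * measure M {h<..}) \<longlongrightarrow> \<beta>) at_top"
    and s_gt_d: "s > real CARD('d)"
    and \<alpha>_pos: "\<alpha> > 0"
  shows "((\<lambda>n::nat. ppp_prob (real n) M (\<lambda>N \<omega>.
            \<forall>i j. is_closest (real n) N \<omega> (- (real n / 4) *\<^sub>R (axis i0 1 :: real^'d)) i \<and>
                  is_closest (real n) N \<omega> ((real n / 4) *\<^sub>R (axis i0 1 :: real^'d)) j \<longrightarrow>
                  chem_dist_ge (real n) N \<omega> i j (real n / (ln (real n)) powr \<alpha>))))
          \<longlonglongrightarrow> 1"
proof -
  define d where "d = CARD('d)"
  have d: "1 \<le> d" "real d < s" using dim s_gt_d by (auto simp: d_def)
  obtain C1 where C1: "0 < C1" "\<And>n t (x :: real^'d). 0 < n \<Longrightarrow> 0 < t \<Longrightarrow>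
    (\<integral>\<^sup>+y. ennreal (exp (- t * torus_dist n y x)) \<partial>torus_uniform n) \<le> ennreal (C1 / (t * n) ^ d)"
    by (rule nn_integral_exp_torus_dist_le[where 'd='d, folded d_def]) (rule that)
  define C where "C = \<beta> + 1"
  have C: "0 < C" using \<beta>_pos by (simp add: C_def)
  obtain h0 where h0: "1 \<le> h0" "\<And>h. h0 \<le> h \<Longrightarrow> measure M {h<..} \<le> C * h powr (- s)"
    using tail_bound[OF tail] unfolding C_def by metis
  \<comment> \<open>Chosen so that 3 e C C1 / \<theta>^d \<le> 1/2, where the 3 comes from N \<le> 3
    n^d; as \<theta> \<ge> 1, the first power of \<theta> suffices.\<close>
  define \<theta> where "\<theta> = 6 * exp 1 * C * C1 + 1"
  have \<theta>: "1 \<le> \<theta>" "6 * exp 1 * C * C1 \<le> \<theta>" using C C1 by (auto simp: \<theta>_def)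
  define \<sigma> where "\<sigma> = s / d"
  have \<sigma>: "1 < \<sigma>" "\<sigma> * d = s" using d by (auto simp: \<sigma>_def field_simps)
  \<comment> \<open>The ratio of consecutive terms \<open>2 ^ j * t j\<close>; it is below 1 because
    s > d.\<close>
  define \<rho> where "\<rho> = (2 :: real) powr (1 - \<sigma>)"
  have \<rho>: "0 < \<rho>" "\<rho> < 1" using \<sigma> by (auto simp: \<rho>_def powr_less_one)
  \<comment> \<open>The lowest scale \<open>j0\<close> is a constant independent of n: it makes the
    geometric tail smaller than 1/4 and puts all thresholds into the range of the tail estimate for
    the marks.\<close>
  have "(\<lambda>j. \<theta> * \<rho> ^ j / (1 - \<rho>)) \<longlonglongrightarrow> \<theta> * 0 / (1 - \<rho>)"
    using \<rho> by (intro tendsto_intros LIMSEQ_realpow_zero) auto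
  then have "\<forall>\<^sub>F j in sequentially. \<theta> * \<rho> ^ j / (1 - \<rho>) < 1 / 4"
    by (rule order_tendstoD) simp
  moreover have "\<forall>\<^sub>F j in sequentially. h0 \<le> 2 ^ j" by real_asymp
  ultimately have "\<forall>\<^sub>F j in sequentially. \<theta> * \<rho> ^ j / (1 - \<rho>) < 1 / 4 \<and> h0 \<le> 2 ^ j"
    by (rule eventually_conj)
  then obtain j0 where j0: "\<theta> * \<rho> ^ j0 / (1 - \<rho>) < 1 / 4" "h0 \<le> 2 ^ j0"
    by (auto dest: eventually_happens)
  \<comment> \<open>As \<sigma> d = s, the power \<open>t j ^ d\<close> is a multiple of the bound
    on the tail at 2^j, and the scale cancels from the mean weight of a step.\<close>
  define t where "t j = \<theta> * (2 ^ j) powr (- \<sigma>)" for j :: nat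
  have t: "0 < t j" for j using \<theta> by (simp add: t_def)
  have t_sum: "(\<Sum>j=j0..J. 2 ^ j * t j) \<le> 1 / 4" for J
  proof -
    have "2 ^ j * t j = \<theta> * \<rho> ^ j" for j
      by (simp add: t_def \<rho>_def powr_diff powr_minus powr_powr power_divide field_simps
          flip: powr_realpow powr_add)
    then have "(\<Sum>j=j0..J. 2 ^ j * t j) = \<theta> * (\<Sum>j=j0..J. \<rho> ^ j)" by (simp add: sum_distrib_left)
    also have "\<dots> \<le> \<theta> * (\<rho> ^ j0 / (1 - \<rho>))"
    proof (rule mult_left_mono)
      show "(\<Sum>j=j0..J. \<rho> ^ j) \<le> \<rho> ^ j0 / (1 - \<rho>)"
        using \<rho> by (simp add: sum_gp divide_right_mono)
    qed (use \<theta> in simp)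
    finally show ?thesis using j0(1) unfolding times_divide_eq_right by linarith
  qed
  \<comment> \<open>The midpoint of d/s and 1. The expected number of marks above n^\<gamma> is then
    of order n^(d - \<gamma> s) = n^(-(s - d)/2).\<close>
  define \<gamma> where "\<gamma> = (d / s + 1) / 2"
  have \<gamma>: "0 < \<gamma>" "\<gamma> < 1" "\<gamma> * s = (d + s) / 2" using d s_pos by (auto simp: \<gamma>_def field_simps)
  define c where "c = 1 - unit_ball_vol CARD('d) / 16 ^ CARD('d)"
  \<comment> \<open>The first term accounts for marks above the cut-off, the second for failures of
    sparseness at all scales.\<close>
  define \<epsilon> where "\<epsilon> n = 3 * C * real n powr (- ((s - d) / 2)) + 6 / real n" for n :: nat
  define L where "L n = real n / ln (real n) powr \<alpha>" for n :: nat
  define E where "E n N \<omega> \<longleftrightarrow> (\<forall>i j. is_closest (real n) N \<omega> (- (real n / 4) *\<^sub>R (axis i0 1 :: real^'d)) i \<and>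
                  is_closest (real n) N \<omega> ((real n / 4) *\<^sub>R (axis i0 1 :: real^'d)) j \<longrightarrow>
                  chem_dist_ge (real n) N \<omega> i j (L n))" for n N \<omega>
  have c: "0 \<le> c" "c < 1"
  proof -
    \<comment> \<open>The base does not depend on the configuration, so any instance will do: here n
      = 1 and no points.\<close>
    show "0 \<le> c"
      unfolding c_def by (rule point_nearby[OF M_prob M_sets, of 1 "0 :: real^'d" 0]) auto
    show "c < 1" by (simp add: c_def)
  qed
  have bounds: "1 - (\<epsilon> n + 2 * exp (real n * (c - 1)) + exp (- real n)) \<le> ppp_prob (real n) M (E n)"
      "ppp_prob (real n) M (E n) \<le> 1"
    if n: "2 \<le> n" "h0 \<le> real n powr \<gamma>" "2 ^ j0 \<le> real n powr \<gamma>"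
      and Ln: "4 * 2 ^ j0 * (L n + 1) + 8 * real n powr \<gamma> * (1 + (d + 2) * ln (real n)) < real n / 4" for n
  proof -
    have n0: "0 < real n" using n by simp
    \<comment> \<open>Then exp(-b) = n^(-(d + 2)), which outweighs the factor N \<le> 3 n^d and a
      number of scales of at most n, leaving 6/n.\<close>
    define b where "b = (d + 2) * ln (real n)"
    have b: "0 \<le> b" using n by (simp add: b_def)
    define q where "q j = C1 / (t j * real n) ^ d" for j
    have "1 \<le> real n powr \<gamma>" using h0 n by linarith
    then obtain J where J: "2 ^ J \<le> real n powr \<gamma>" "real n powr \<gamma> < 2 ^ Suc J"
      by (rule dyadic_bracket)
    have j0_J: "j0 \<le> Suc J"
    proof -
      have "(2 :: real) ^ j0 < 2 ^ Suc J" using n J by linarith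
      then show ?thesis by (metis less_imp_le one_less_numeral_iff power_less_imp_less_exp semiring_norm(76))
    qed
    have small: "exp 1 * measure M {2 ^ j<..} * q j * N \<le> 1 / 2"
      if N: "real N \<le> 3 * real n ^ d" and j: "j0 \<le> j" for j N
    proof -
      have "h0 \<le> 2 ^ j" using j0 j by (meson order_trans power_increasing one_le_numeral)
      then have "exp 1 * measure M {2 ^ j<..} * q j * N \<le> exp 1 * (C * (2 ^ j) powr (- s)) * q j * (3 * real n ^ d)"
        using N C1 t[of j] by (intro mult_mono mult_left_mono h0) (auto simp: q_def C less_imp_le)
      also have "\<dots> = 3 * exp 1 * C * C1 * (2 ^ j) powr (- s) / t j ^ d"
        using n0 t[of j] by (simp add: q_def power_mult_distrib field_simps)
      also have "t j ^ d = \<theta> ^ d * (2 ^ j) powr (- s)"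
        unfolding \<sigma>(2)[symmetric]
        by (simp add: t_def power_mult_distrib powr_powr mult.assoc flip: powr_realpow)
      also have "3 * exp 1 * C * C1 * (2 ^ j) powr (- s) / \<dots> = 3 * exp 1 * C * C1 / \<theta> ^ d"
        by simp
      also have "\<dots> \<le> 3 * exp 1 * C * C1 / \<theta>"
        using \<theta> d C C1 by (intro divide_left_mono self_le_power) auto
      also have "\<dots> \<le> 1 / 2" using \<theta> by (simp add: field_simps)
      finally show ?thesis .
    qed
    have fail: "measure (marked_points (real n) M N) {\<omega> \<in> space (marked_points (real n) M N). \<not> E n N \<omega>} \<le> \<epsilon> n + 2 * c ^ N"
      if N: "real N \<le> 3 * real n ^ CARD('d)" for N
    proof -
      have N': "real N \<le> 3 * real n ^ d" using N by (simp add: d_def)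
      have "measure (marked_points (real n) M N) {\<omega> \<in> space (marked_points (real n) M N). \<not> E n N \<omega>} \<le>
        real N * measure M {2 ^ Suc J<..} + real (Suc J) * (2 * real N * exp (- b)) + 2 * c ^ N"
        unfolding E_def c_def
      proof (rule chem_dist_fail_prob_le[OF M_prob M_sets n0 _ _ _ j0_J b t_sum])
        fix j x
        show "(\<integral>\<^sup>+y. ennreal (exp (- t j * torus_dist (real n) y (x :: real^'d))) \<partial>torus_uniform (real n)) \<le> ennreal (q j)"
          unfolding q_def by (rule C1(2)[OF n0 t])
        show "0 \<le> q j" using C1 t[of j] by (simp add: q_def)
        show "0 \<le> t j" using t[of j] by simp
        show "exp 1 * measure M {2 ^ j<..} * q j * N \<le> 1 / 2" if "j0 \<le> j"
          using small[OF N' that] .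
        have "8 * 2 ^ J * (1 + b) \<le> 8 * real n powr \<gamma> * (1 + b)"
          using J b by (intro mult_right_mono) auto
        then show "4 * 2 ^ j0 * (L n + 1) + 8 * 2 ^ J * (1 + b) < real n / 4"
          using Ln unfolding b_def by linarith
      qed
      also have "real N * measure M {2 ^ Suc J<..} \<le> 3 * C * real n powr (- ((s - d) / 2))"
      proof -
        have "measure M {2 ^ Suc J<..} \<le> C * (2 ^ Suc J) powr (- s)"
          using J n by (intro h0) linarith
        also have "\<dots> \<le> C * (real n powr \<gamma>) powr (- s)"
          using J C s_pos n0 by (intro mult_left_mono powr_mono2') auto
        finally have "real N * measure M {2 ^ Suc J<..} \<le> (3 * real n ^ d) * (C * (real n powr \<gamma>) powr (- s))"
          using N' by (intro mult_mono) auto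
        also have "\<dots> = 3 * C * (real n powr d * real n powr (- (\<gamma> * s)))"
          using n0 by (simp add: powr_powr powr_realpow)
        also have "real n powr d * real n powr (- (\<gamma> * s)) = real n powr (- ((s - d) / 2))"
          unfolding \<gamma>(3) powr_add[symmetric] by (rule arg_cong[of _ _ "\<lambda>u. real n powr u"]) (simp add: field_simps)
        finally show ?thesis .
      qed
      also have "real (Suc J) * (2 * real N * exp (- b)) \<le> 6 / real n"
      proof -
        have exp_b: "exp (- b) = 1 / real n ^ (d + 2)"
        proof -
          have "b = real (d + 2) * ln (real n)" by (simp add: b_def)
          then have "exp (- b) = inverse (exp (ln (real n)) ^ (d + 2))"
            by (simp only: exp_minus exp_of_nat_mult)
          then show ?thesis using n0 by (simp add: divide_inverse)
        qed
        have "real (Suc J) \<le> 2 ^ J" using less_exp[of J] by (metis Suc_leI of_nat_le_iff of_nat_numeral of_nat_power)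
        also have "\<dots> \<le> real n powr \<gamma>" by (rule J)
        also have "\<dots> \<le> real n powr 1" using \<gamma> n by (intro powr_mono) auto
        also have "\<dots> = real n" using n0 by simp
        finally have "real (Suc J) * (2 * real N * exp (- b)) \<le> real n * (2 * (3 * real n ^ d) * exp (- b))"
          using N' by (intro mult_mono) auto
        also have "\<dots> = 6 / real n"
          unfolding exp_b using n0 by (simp add: field_simps power2_eq_square)
        finally show ?thesis .
      qed
      finally show ?thesis by (simp add: \<epsilon>_def)
    qed
    have pred: "Measurable.pred (marked_points (real n) M N) (E n N)" for N
      unfolding E_def using M_sets by (rule pred_chem_dist_ge)
    have \<epsilon>: "0 \<le> \<epsilon> n" using C by (simp add: \<epsilon>_def)
    note ppp = ppp_prob_bounds[OF M_prob M_sets n0 pred c(1) \<epsilon> fail]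
    show "ppp_prob (real n) M (E n) \<le> 1" by (rule ppp(2))
    have n_le: "real n \<le> real n ^ CARD('d)" using n dim by (intro self_le_power) auto
    then have "exp (real n ^ CARD('d) * (c - 1)) \<le> exp (real n * (c - 1))"
      "exp (- (real n ^ CARD('d))) \<le> exp (- real n)"
      using c by (auto intro!: mult_right_mono_neg)
    with ppp(1) show "1 - (\<epsilon> n + 2 * exp (real n * (c - 1)) + exp (- real n)) \<le> ppp_prob (real n) M (E n)"
      by linarith
  qed
  have "\<forall>\<^sub>F n in sequentially. h0 \<le> real n powr \<gamma>" using \<gamma> by real_asymp
  moreover have "\<forall>\<^sub>F n in sequentially. 2 ^ j0 \<le> real n powr \<gamma>" using \<gamma> by real_asymp
  \<comment> \<open>Both terms are o(n): the first because \<open>j0\<close> is fixed and \<alpha> >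
    0, the second because \<gamma> < 1 leaves room for the logarithm.\<close>
  moreover have "\<forall>\<^sub>F n in sequentially. 4 * 2 ^ j0 * (L n + 1) + 8 * real n powr \<gamma> * (1 + (d + 2) * ln (real n)) < real n / 4"
    unfolding L_def using \<gamma> \<alpha>_pos by real_asymp
  ultimately have ev: "\<forall>\<^sub>F n in sequentially.
      1 - (\<epsilon> n + 2 * exp (real n * (c - 1)) + exp (- real n)) \<le> ppp_prob (real n) M (E n) \<and>
      ppp_prob (real n) M (E n) \<le> 1"
    using eventually_ge_at_top[of 2] by eventually_elim (use bounds in blast)
  have "(\<lambda>n. 1 - (\<epsilon> n + 2 * exp (real n * (c - 1)) + exp (- real n))) \<longlonglongrightarrow> 1"
  proof -
    define \<delta> \<kappa> where "\<delta> = (s - d) / 2" and "\<kappa> = 1 - c"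
    have pos: "0 < \<delta>" "0 < \<kappa>" and c_eq: "c - 1 = - \<kappa>" using c(2) d(2) by (auto simp: \<delta>_def \<kappa>_def)
    have "(\<lambda>n. 3 * C * real n powr (- \<delta>)) \<longlonglongrightarrow> 0" using pos C by real_asymp
    moreover have "(\<lambda>n. 6 / real n + 2 * exp (real n * - \<kappa>) + exp (- real n)) \<longlonglongrightarrow> 0" using pos by real_asymp
    ultimately have "(\<lambda>n. 1 - (3 * C * real n powr (- \<delta>) + (6 / real n + 2 * exp (real n * - \<kappa>) + exp (- real n)))) \<longlonglongrightarrow> 1 - (0 + 0)"
      by (intro tendsto_intros)
    then show ?thesis unfolding \<epsilon>_def c_eq \<delta>_def by (simp add: add.assoc)
  qed
  then have "(\<lambda>n. ppp_prob (real n) M (E n)) \<longlonglongrightarrow> 1"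
    by (rule tendsto_sandwich[rotated 2, OF _ tendsto_const]) (use ev in \<open>auto elim: eventually_mono\<close>)
  then show ?thesis unfolding E_def L_def .
qed

end
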